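(* Let $V$ be a vertex operator algebra with a vertex tensor category of modules $\mathcal C$ (in the sense of Huang–Lepowsky–Zhang), and assume that this tensor category is ribbon. Then for a self-dual simple current $J$ with conformal dimension $h_J$, $$c_{J,J}\,\operatorname{qdim}(J)=e^{2\pi i h_J},$$ where $\operatorname{qdim}(J)=\operatorname{tr}_J(\mathrm{Id}_J)$.
   Context: $\mathcal C$ is a category of (grading-restricted) generalized $V$-modules to which the Huang–Lepowsky–Zhang theory applies, with tensor product $\boxtimes=\boxtimes_{P(1)}$, unit object $V$, braiding $c_{A,B}:A\boxtimes B\to B\boxtimes A$ characterized by $\overline{c_{A,B}}(a\boxtimes b)=e^{L(-1)}\mathcal Y_\boxtimes(b,e^{\pi i})a$ ($\mathcal Y_\boxtimes$ being the intertwining operator of type $\binom{B\boxtimes A}{B\,A}$ corresponding to the universal $P(1)$-intertwining map), and twist $\theta_X=e^{2\pi iL(0)}$. Ribbon means that $\mathcal C$ is rigid with pivotal structure $\psi_X:X\to X^{**}$ whose associated twist (defined by $\psi_X=u_X\theta_X$, with $u_X:X\to X^{**}$ the natural isomorphism built from the braiding and duality) is $\theta$, and whose left and right traces coincide; $\operatorname{tr}_X$ denotes this trace, with values in $\operatorname{End}(V)=\mathbb C$. A simple current is an invertible simple object; it is self-dual if $J\boxtimes J\cong V$. Since $J\boxtimes J\cong V$, the braiding $c_{J,J}$ is a scalar multiple of $\mathrm{Id}_{J\boxtimes J}$ and is identified with that scalar. The conformal dimension $h_J$ is the lowest $L(0)$-eigenvalue (conformal weight of the lowest weight vectors) of $J$.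 *)

theory Defs
  imports "HOL-Analysis.Analysis" "HOL-Library.Groups_Big_Fun"
begin

section \<open>Complex vector spaces\<close>

class complex_vector_space = ab_group_add +
  fixes scaleC :: "complex \<Rightarrow> 'a \<Rightarrow> 'a"  (infixr "*\<^sub>C" 75)
  assumes scaleC_add_right: "a *\<^sub>C (x + y) = a *\<^sub>C x + a *\<^sub>C y"
    and scaleC_add_left: "(a + b) *\<^sub>C x = a *\<^sub>C x + b *\<^sub>C x"
    and scaleC_scaleC: "a *\<^sub>C b *\<^sub>C x = (a * b) *\<^sub>C x"
    and scaleC_one: "1 *\<^sub>C x = x"

global_interpretation cvs:
  vector_space "scaleC :: complex \<Rightarrow> 'a \<Rightarrow> 'a::complex_vector_space"
  by unfold_locales
    (simp_all add: scaleC_add_right scaleC_add_left scaleC_scaleC scaleC_one)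

definition linear_on ::
  "'a::complex_vector_space set \<Rightarrow> 'b::complex_vector_space set \<Rightarrow> ('a \<Rightarrow> 'b) \<Rightarrow> bool" where
  "linear_on A B f \<longleftrightarrow>
     (\<forall>x\<in>A. f x \<in> B) \<and>
     (\<forall>x\<in>A. \<forall>y\<in>A. f (x + y) = f x + f y) \<and>
     (\<forall>c. \<forall>x\<in>A. f (c *\<^sub>C x) = c *\<^sub>C f x)"

definition bilinear_on ::
  "'a::complex_vector_space set \<Rightarrow> 'b::complex_vector_space set \<Rightarrow>
   'c::complex_vector_space set \<Rightarrow> ('a \<Rightarrow> 'b \<Rightarrow> 'c) \<Rightarrow> bool" where
  "bilinear_on A B C f \<longleftrightarrow>
     (\<forall>x\<in>A. linear_on B C (f x)) \<and> (\<forall>y\<in>B. linear_on A C (\<lambda>x. f x y))"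

text \<open>
  Unconditional (equivalently absolute) convergence of a family tested against all linear
  functionals.  It is only applied to families lying in one finite-dimensional weight space, where
  it is convergence in the usual topology.
\<close>

definition weak_has_sum :: "('i \<Rightarrow> 'a::complex_vector_space) \<Rightarrow> 'a \<Rightarrow> bool" where
  "weak_has_sum f s \<longleftrightarrow>
     (\<forall>\<phi>. Vector_Spaces.linear scaleC ((*) :: complex \<Rightarrow> complex \<Rightarrow> complex) \<phi> \<longrightarrow>
        ((\<lambda>i. \<phi> (f i)) has_sum \<phi> s) UNIV)"


section \<open>Vertex operator algebras and their generalized modules\<close>

text \<open>
  A vertex operator algebra and all the modules of a given category live on subspaces of one
  ambient complex vector space, the type \<open>'a\<close>.  Any small category of modules is isomorphic to one
  of this form.  \<open>act M v n w\<close> is \<open>v\<^sub>n w\<close>, where \<open>Y(v,x) = \<Sum> v\<^sub>n x\<^sup>-\<^sup>n\<^sup>-\<^sup>1\<close>.  Values of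
  the operations off the carriers are irrelevant.
\<close>

record 'a vmod =
  car :: "'a set"
  act :: "'a \<Rightarrow> int \<Rightarrow> 'a \<Rightarrow> 'a"

record 'a voa =
  adj :: "'a vmod"  \<comment> \<open>the underlying space with its vertex operators\<close>
  vac :: 'a
  conf :: 'a
  charge :: complex

definition vir :: "'a voa \<Rightarrow> 'a vmod \<Rightarrow> int \<Rightarrow> 'a \<Rightarrow> 'a" where
  "vir V M n = act M (conf V) (n + 1)"

definition gwt :: "'a::complex_vector_space voa \<Rightarrow> 'a vmod \<Rightarrow> complex \<Rightarrow> 'a set" where
  "gwt V M n = {w \<in> car M. \<exists>k. ((\<lambda>x. vir V M 0 x - n *\<^sub>C x) ^^ k) w = 0}"

text \<open>
  The component form of the Jacobi identity: the coefficient of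
  \<open>x\<^sub>0\<^sup>-\<^sup>l\<^sup>-\<^sup>1 x\<^sub>1\<^sup>-\<^sup>m\<^sup>-\<^sup>1 x\<^sub>2\<^sup>-\<^sup>n\<^sup>-\<^sup>1\<close>.  All sums are finite by lower truncation.
\<close>

definition module_jacobi :: "'a::complex_vector_space voa \<Rightarrow> 'a vmod \<Rightarrow> bool" where
  "module_jacobi V M \<longleftrightarrow>
     (\<forall>u\<in>car (adj V). \<forall>v\<in>car (adj V). \<forall>w\<in>car M. \<forall>l m n :: int.
        Sum_any (\<lambda>i::nat. ((-1) ^ i * (of_int l gchoose i)) *\<^sub>C
            (act M u (m + l - int i) (act M v (n + int i) w)
             - ((-1) powi l) *\<^sub>C act M v (n + l - int i) (act M u (m + int i) w)))
        = Sum_any (\<lambda>i::nat. (of_int m gchoose i) *\<^sub>C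
            act M (act (adj V) u (l + int i) v) (m + n - int i) w))"

definition generalized_module :: "'a::complex_vector_space voa \<Rightarrow> 'a vmod \<Rightarrow> bool" where
  "generalized_module V M \<longleftrightarrow>
     cvs.subspace (car M) \<and>
     (\<forall>n. bilinear_on (car (adj V)) (car M) (car M) (\<lambda>v. act M v n)) \<and>
     (\<forall>v\<in>car (adj V). \<forall>w\<in>car M. \<exists>N. \<forall>n\<ge>N. act M v n w = 0) \<and>
     (\<forall>w\<in>car M. \<forall>n. act M (vac V) n w = (if n = -1 then w else 0)) \<and>
     module_jacobi V M \<and>
     (\<forall>m n. \<forall>w\<in>car M. vir V M m (vir V M n w) - vir V M n (vir V M m w) =
        of_int (m - n) *\<^sub>C vir V M (m + n) w +
        (if m + n = 0 then (of_int (m ^ 3 - m) / 12 * charge V) *\<^sub>C w else 0)) \<and>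
     (\<forall>v\<in>car (adj V). \<forall>w\<in>car M. \<forall>n.
        act M (vir V (adj V) (-1) v) n w = of_int (- n) *\<^sub>C act M v (n - 1) w) \<and>
     (\<forall>w\<in>car M. \<exists>f. finite {n. f n \<noteq> 0} \<and> (\<forall>n. f n \<in> gwt V M n) \<and> w = Sum_any f)"

definition grading_restricted :: "'a::complex_vector_space voa \<Rightarrow> 'a vmod \<Rightarrow> bool" where
  "grading_restricted V M \<longleftrightarrow>
     (\<forall>n. \<exists>B. finite B \<and> gwt V M n \<subseteq> cvs.span B) \<and>
     (\<forall>n. \<exists>N::nat. \<forall>k\<ge>N. gwt V M (n - of_nat k) = {0})"

definition voa_wt :: "'a::complex_vector_space voa \<Rightarrow> int \<Rightarrow> 'a set" where
  "voa_wt V n = {v \<in> car (adj V). vir V (adj V) 0 v = of_int n *\<^sub>C v}"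

locale vertex_operator_algebra =
  fixes V :: "'a::complex_vector_space voa"
  assumes vac_in: "vac V \<in> voa_wt V 0"
    and conf_in: "conf V \<in> voa_wt V 2"
    and adjoint_module: "generalized_module V (adj V)"
    and creation: "v \<in> car (adj V) \<Longrightarrow> act (adj V) v (-1) (vac V) = v"
      "v \<in> car (adj V) \<Longrightarrow> n \<ge> 0 \<Longrightarrow> act (adj V) v n (vac V) = 0"
    and integer_grading: "v \<in> car (adj V) \<Longrightarrow>
      \<exists>f. finite {n. f n \<noteq> 0} \<and> (\<forall>n. f n \<in> voa_wt V n) \<and> v = Sum_any f"
    and finite_dim_wt: "\<exists>B. finite B \<and> voa_wt V n \<subseteq> cvs.span B"
    and bounded_below: "\<exists>N. \<forall>n<N. voa_wt V n = {0}"

text \<open>The component of \<open>w\<close> of generalized weight \<open>n\<close>.\<close>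

definition wt_comp ::
  "'a::complex_vector_space voa \<Rightarrow> 'a vmod \<Rightarrow> 'a \<Rightarrow> complex \<Rightarrow> 'a" where
  "wt_comp V M w =
     (THE f. finite {n. f n \<noteq> 0} \<and> (\<forall>n. f n \<in> gwt V M n) \<and> w = Sum_any f)"

text \<open>
  The algebraic completion is the product of the weight spaces; \<^const>\<open>wt_comp\<close> is the embedding
  of a module into it.
\<close>

definition compl :: "'a::complex_vector_space voa \<Rightarrow> 'a vmod \<Rightarrow> (complex \<Rightarrow> 'a) set" where
  "compl V M = {F. \<forall>n. F n \<in> gwt V M n}"

definition compl_act ::
  "'a::complex_vector_space voa \<Rightarrow> 'a vmod \<Rightarrow> 'a \<Rightarrow> int \<Rightarrow> (complex \<Rightarrow> 'a) \<Rightarrow> complex \<Rightarrow> 'a" where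
  "compl_act V M v k F p = Sum_any (\<lambda>q. wt_comp V M (act M v k (F q)) p)"

text \<open>\<open>e\<^bsup>L(-1)\<^esup>\<close> on the algebraic completion.\<close>

definition exp_Lm1 ::
  "'a::complex_vector_space voa \<Rightarrow> 'a vmod \<Rightarrow> (complex \<Rightarrow> 'a) \<Rightarrow> complex \<Rightarrow> 'a" where
  "exp_Lm1 V M F p =
     Sum_any (\<lambda>k::nat. (1 / fact k) *\<^sub>C (vir V M (-1) ^^ k) (F (p - of_nat k)))"

text \<open>\<open>e\<^bsup>\<zeta>L(0)\<^esup>\<close>; on the generalized weight space of weight \<open>n\<close>, \<open>L(0) - n\<close> is locally nilpotent.\<close>

definition exp_L0 ::
  "'a::complex_vector_space voa \<Rightarrow> 'a vmod \<Rightarrow> complex \<Rightarrow> 'a \<Rightarrow> 'a" where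
  "exp_L0 V M \<zeta> w = Sum_any (\<lambda>(n, k::nat). (exp (\<zeta> * n) * \<zeta> ^ k / fact k) *\<^sub>C
     ((\<lambda>x. vir V M 0 x - n *\<^sub>C x) ^^ k) (wt_comp V M w n))"

definition L0_eigenvalue :: "'a::complex_vector_space voa \<Rightarrow> 'a vmod \<Rightarrow> complex \<Rightarrow> bool" where
  "L0_eigenvalue V M h \<longleftrightarrow> (\<exists>w\<in>car M. w \<noteq> 0 \<and> vir V M 0 w = h *\<^sub>C w)"

definition conformal_dim :: "'a::complex_vector_space voa \<Rightarrow> 'a vmod \<Rightarrow> complex" where
  "conformal_dim V M =
     (THE h. L0_eigenvalue V M h \<and> (\<forall>n. L0_eigenvalue V M n \<longrightarrow> Re h \<le> Re n))"

definition irreducible_module :: "'a::complex_vector_space voa \<Rightarrow> 'a vmod \<Rightarrow> bool" where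
  "irreducible_module V M \<longleftrightarrow>
     car M \<noteq> {0} \<and>
     (\<forall>S. cvs.subspace S \<and> S \<subseteq> car M \<and>
          (\<forall>v\<in>car (adj V). \<forall>n. \<forall>w\<in>S. act M v n w \<in> S) \<longrightarrow> S = {0} \<or> S = car M)"


section \<open>Intertwining maps and logarithmic intertwining operators\<close>

text \<open>
  \<open>P(z)\<close>-intertwining maps of type \<open>(W3; W1 W2)\<close>, with values in the completion of \<open>W3\<close>.  The
  last condition is the coefficient of \<open>x\<^sub>0\<^sup>-\<^sup>l\<^sup>-\<^sup>1 x\<^sub>1\<^sup>-\<^sup>m\<^sup>-\<^sup>1\<close> in
  \<open>x\<^sub>0\<^sup>-\<^sup>1\<delta>((x\<^sub>1-z)/x\<^sub>0) Y\<^sub>3(v,x\<^sub>1)I(w\<^sub>1,w\<^sub>2) =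
   z\<^sup>-\<^sup>1\<delta>((x\<^sub>1-x\<^sub>0)/z) I(Y\<^sub>1(v,x\<^sub>0)w\<^sub>1,w\<^sub>2) + x\<^sub>0\<^sup>-\<^sup>1\<delta>((z-x\<^sub>1)/(-x\<^sub>0)) I(w\<^sub>1,Y\<^sub>2(v,x\<^sub>1)w\<^sub>2)\<close>.
\<close>

definition intertwining_map ::
  "'a::complex_vector_space voa \<Rightarrow> complex \<Rightarrow> 'a vmod \<Rightarrow> 'a vmod \<Rightarrow> 'a vmod \<Rightarrow>
   ('a \<Rightarrow> 'a \<Rightarrow> complex \<Rightarrow> 'a) \<Rightarrow> bool" where
  "intertwining_map V z W1 W2 W3 I \<longleftrightarrow>
     (\<forall>p. bilinear_on (car W1) (car W2) (gwt V W3 p) (\<lambda>w1 w2. I w1 w2 p)) \<and>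
     (\<forall>w1\<in>car W1. \<forall>w2\<in>car W2. \<forall>p. \<exists>N::nat. \<forall>k\<ge>N. I w1 w2 (p - of_nat k) = 0) \<and>
     (\<forall>v\<in>car (adj V). \<forall>w1\<in>car W1. \<forall>w2\<in>car W2. \<forall>l m :: int. \<forall>p.
        Sum_any (\<lambda>i::nat. ((of_int l gchoose i) * (- z) ^ i) *\<^sub>C
          compl_act V W3 v (m + l - int i) (I w1 w2) p)
        = Sum_any (\<lambda>i::nat. ((of_int m gchoose i) * z powi (m - int i)) *\<^sub>C
            I (act W1 v (l + int i) w1) w2 p)
        + Sum_any (\<lambda>i::nat. ((-1) powi l * (-1) ^ i * (of_int l gchoose i)
              * z powi (l - int i)) *\<^sub>C
            I w1 (act W2 v (m + int i) w2) p))"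

text \<open>
  A logarithmic intertwining operator is given by its coefficients:
  \<open>\<Y>(w1,x)w2 = \<Sum>\<^sub>n\<^sub>,\<^sub>k \<Y> w1 n k w2 x\<^sup>-\<^sup>n\<^sup>-\<^sup>1 (log x)\<^sup>k\<close>, with \<open>n\<close> complex.  The last condition is
  \<open>\<Y>(L(-1)w1,x) = d/dx \<Y>(w1,x)\<close>.
\<close>

definition log_intertwining_op ::
  "'a::complex_vector_space voa \<Rightarrow> 'a vmod \<Rightarrow> 'a vmod \<Rightarrow> 'a vmod \<Rightarrow>
   ('a \<Rightarrow> complex \<Rightarrow> nat \<Rightarrow> 'a \<Rightarrow> 'a) \<Rightarrow> bool" where
  "log_intertwining_op V W1 W2 W3 \<Y> \<longleftrightarrow>
     (\<forall>n k. bilinear_on (car W1) (car W2) (car W3) (\<lambda>w1. \<Y> w1 n k)) \<and>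
     (\<forall>w1\<in>car W1. \<forall>w2\<in>car W2. \<forall>n. finite {k. \<Y> w1 n k w2 \<noteq> 0}) \<and>
     (\<forall>w1\<in>car W1. \<forall>w2\<in>car W2. \<forall>n. \<exists>N::nat. \<forall>j\<ge>N. \<forall>k. \<Y> w1 (n + of_nat j) k w2 = 0) \<and>
     (\<forall>v\<in>car (adj V). \<forall>w1\<in>car W1. \<forall>w2\<in>car W2. \<forall>l m :: int. \<forall>n k.
        Sum_any (\<lambda>i::nat. ((-1) ^ i * (of_int l gchoose i)) *\<^sub>C
            (act W3 v (m + l - int i) (\<Y> w1 (n + of_nat i) k w2)
             - ((-1) powi l) *\<^sub>C \<Y> w1 (n + of_int l - of_nat i) k (act W2 v (m + int i) w2)))
        = Sum_any (\<lambda>i::nat. (of_int m gchoose i) *\<^sub>C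
            \<Y> (act W1 v (l + int i) w1) (of_int m + n - of_nat i) k w2)) \<and>
     (\<forall>w1\<in>car W1. \<forall>w2\<in>car W2. \<forall>n k.
        \<Y> (vir V W1 (-1) w1) n k w2 =
          (- n) *\<^sub>C \<Y> w1 (n - 1) k w2 + of_nat (k + 1) *\<^sub>C \<Y> w1 (n - 1) (k + 1) w2)"

text \<open>
  \<open>\<Y>(w1,e\<^sup>\<zeta>)w2\<close> in the completion of \<open>W3\<close>: \<open>x\<^sup>s\<close> is replaced by \<open>e\<^bsup>s\<zeta>\<^esup>\<close> and \<open>log x\<close> by \<open>\<zeta>\<close>.
\<close>

definition op_at ::
  "'a::complex_vector_space voa \<Rightarrow> 'a vmod \<Rightarrow> ('a \<Rightarrow> complex \<Rightarrow> nat \<Rightarrow> 'a \<Rightarrow> 'a) \<Rightarrow> complex \<Rightarrow>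
   'a \<Rightarrow> 'a \<Rightarrow> complex \<Rightarrow> 'a" where
  "op_at V W3 \<Y> \<zeta> w1 w2 p =
     Sum_any (\<lambda>(n, k). (exp (- (n + 1) * \<zeta>) * \<zeta> ^ k) *\<^sub>C wt_comp V W3 (\<Y> w1 n k w2) p)"


section \<open>Module homomorphisms\<close>

text \<open>
  Morphisms carry their source and target, and are normalised to be 0 off the carrier of the
  source, so that two morphisms are equal iff the underlying maps agree on the source.
\<close>

record 'a arr =
  src :: "'a vmod"
  tgt :: "'a vmod"
  app :: "'a \<Rightarrow> 'a"

definition arr_comp :: "'a arr \<Rightarrow> 'a arr \<Rightarrow> 'a arr"  (infixr "\<cdot>" 65) where
  "g \<cdot> f = \<lparr>src = src f, tgt = tgt g, app = app g \<circ> app f\<rparr>"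

definition id_arr :: "'a::zero vmod \<Rightarrow> 'a arr" where
  "id_arr X = \<lparr>src = X, tgt = X, app = (\<lambda>x. if x \<in> car X then x else 0)\<rparr>"

definition scale_arr :: "complex \<Rightarrow> 'a::complex_vector_space arr \<Rightarrow> 'a arr" where
  "scale_arr c f = \<lparr>src = src f, tgt = tgt f, app = (\<lambda>x. c *\<^sub>C app f x)\<rparr>"

definition hom ::
  "'a::complex_vector_space voa \<Rightarrow> 'a vmod \<Rightarrow> 'a vmod \<Rightarrow> 'a arr set" where
  "hom V X Y = {f. src f = X \<and> tgt f = Y \<and>
     linear_on (car X) (car Y) (app f) \<and>
     (\<forall>v\<in>car (adj V). \<forall>n. \<forall>w\<in>car X. app f (act X v n w) = act Y v n (app f w)) \<and>
     (\<forall>x. x \<notin> car X \<longrightarrow> app f x = 0)}"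

definition is_inverse :: "'a::complex_vector_space voa \<Rightarrow> 'a arr \<Rightarrow> 'a arr \<Rightarrow> bool" where
  "is_inverse V f g \<longleftrightarrow>
     g \<in> hom V (tgt f) (src f) \<and> g \<cdot> f = id_arr (src f) \<and> f \<cdot> g = id_arr (tgt f)"

definition inv_arr :: "'a::complex_vector_space voa \<Rightarrow> 'a arr \<Rightarrow> 'a arr" where
  "inv_arr V f = (THE g. is_inverse V f g)"

definition iso ::
  "'a::complex_vector_space voa \<Rightarrow> 'a vmod \<Rightarrow> 'a vmod \<Rightarrow> 'a arr set" where
  "iso V X Y = {f \<in> hom V X Y. \<exists>g. is_inverse V f g}"

definition isomorphic :: "'a::complex_vector_space voa \<Rightarrow> 'a vmod \<Rightarrow> 'a vmod \<Rightarrow> bool" where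
  "isomorphic V X Y \<longleftrightarrow> iso V X Y \<noteq> {}"

definition scalar_of :: "'a::complex_vector_space arr \<Rightarrow> complex" where
  "scalar_of f = (THE c. f = scale_arr c (id_arr (src f)))"

text \<open>The twist \<open>\<theta>\<^sub>X = e\<^bsup>2\<pi>iL(0)\<^esup>\<close>.\<close>

definition twist :: "'a::complex_vector_space voa \<Rightarrow> 'a vmod \<Rightarrow> 'a arr" where
  "twist V X = \<lparr>src = X, tgt = X,
     app = (\<lambda>x. if x \<in> car X then exp_L0 V X (2 * pi * \<i>) x else 0)\<rparr>"

text \<open>The universal property of a \<open>P(z)\<close>-tensor product in the full subcategory on \<open>Ob\<close>.\<close>

definition Pz_tensor_product ::
  "'a::complex_vector_space voa \<Rightarrow> 'a vmod set \<Rightarrow> complex \<Rightarrow> 'a vmod \<Rightarrow> 'a vmod \<Rightarrow>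
   'a vmod \<Rightarrow> ('a \<Rightarrow> 'a \<Rightarrow> complex \<Rightarrow> 'a) \<Rightarrow> bool" where
  "Pz_tensor_product V Ob z W1 W2 T I \<longleftrightarrow>
     T \<in> Ob \<and> intertwining_map V z W1 W2 T I \<and>
     (\<forall>W\<in>Ob. \<forall>G. intertwining_map V z W1 W2 W G \<longrightarrow>
        (\<exists>!\<eta>. \<eta> \<in> hom V T W \<and>
           (\<forall>w1\<in>car W1. \<forall>w2\<in>car W2. \<forall>p. app \<eta> (I w1 w2 p) = G w1 w2 p)))"


section \<open>Vertex tensor categories\<close>

text \<open>
  The full subcategory of generalized modules on \<open>obj\<close>, with \<open>ten X Y\<close> the \<open>P(1)\<close>-tensor product,
  \<open>box X Y\<close> its universal \<open>P(1)\<close>-intertwining map, and the associativity, left and right unit and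
  braiding isomorphisms.
\<close>

record 'a tensor_data =
  obj :: "'a vmod set"
  ten :: "'a vmod \<Rightarrow> 'a vmod \<Rightarrow> 'a vmod"
  box :: "'a vmod \<Rightarrow> 'a vmod \<Rightarrow> 'a \<Rightarrow> 'a \<Rightarrow> complex \<Rightarrow> 'a"
  asc :: "'a vmod \<Rightarrow> 'a vmod \<Rightarrow> 'a vmod \<Rightarrow> 'a arr"
  lun :: "'a vmod \<Rightarrow> 'a arr"
  run :: "'a vmod \<Rightarrow> 'a arr"
  brd :: "'a vmod \<Rightarrow> 'a vmod \<Rightarrow> 'a arr"

locale module_tensor_data =
  fixes V :: "'a::complex_vector_space voa" and C :: "'a tensor_data"
begin

abbreviation tensor_obj :: "'a vmod \<Rightarrow> 'a vmod \<Rightarrow> 'a vmod"  (infixr "\<otimes>" 72) where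
  "X \<otimes> Y \<equiv> ten C X Y"

abbreviation unit_obj :: "'a vmod"  ("\<one>") where
  "\<one> \<equiv> adj V"

definition tensor_arr :: "'a arr \<Rightarrow> 'a arr \<Rightarrow> 'a arr"  (infixr "\<otimes>\<^sub>a" 72) where
  "f \<otimes>\<^sub>a g = (THE h. h \<in> hom V (src f \<otimes> src g) (tgt f \<otimes> tgt g) \<and>
     (\<forall>x\<in>car (src f). \<forall>y\<in>car (src g). \<forall>p.
        app h (box C (src f) (src g) x y p) = box C (tgt f) (tgt g) (app f x) (app g y) p))"

text \<open>
  The logarithmic intertwining operator corresponding to the universal \<open>P(1)\<close>-intertwining map
  (with \<open>log 1 = 0\<close>); its values on the carriers are determined by this condition.
\<close>

definition tensor_op :: "'a vmod \<Rightarrow> 'a vmod \<Rightarrow> 'a \<Rightarrow> complex \<Rightarrow> nat \<Rightarrow> 'a \<Rightarrow> 'a" where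
  "tensor_op X Y = (SOME \<Y>. log_intertwining_op V X Y (X \<otimes> Y) \<Y> \<and>
     (\<forall>x\<in>car X. \<forall>y\<in>car Y. op_at V (X \<otimes> Y) \<Y> 0 x y = box C X Y x y))"

abbreviation tensor_op_at :: "'a vmod \<Rightarrow> 'a vmod \<Rightarrow> complex \<Rightarrow> 'a \<Rightarrow> 'a \<Rightarrow> complex \<Rightarrow> 'a" where
  "tensor_op_at X Y \<equiv> op_at V (X \<otimes> Y) (tensor_op X Y)"

definition simple_current :: "'a vmod \<Rightarrow> bool" where
  "simple_current J \<longleftrightarrow>
     J \<in> obj C \<and> irreducible_module V J \<and>
     (\<exists>K\<in>obj C. isomorphic V (J \<otimes> K) \<one> \<and> isomorphic V (K \<otimes> J) \<one>)"

definition self_dual_current :: "'a vmod \<Rightarrow> bool" where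
  "self_dual_current J \<longleftrightarrow> simple_current J \<and> isomorphic V (J \<otimes> J) \<one>"

definition braiding_scalar :: "'a vmod \<Rightarrow> complex" where
  "braiding_scalar J = scalar_of (brd C J J)"

end

text \<open>
  The outcome of the Huang--Lepowsky--Zhang construction: \<open>P(1)\<close>-tensor products exist in the
  category, the structure isomorphisms are the ones prescribed by the theory, and they form a
  braided tensor category.  \<open>asc_char\<close> says that for \<open>r1 > r2 > r1 - r2 > 0\<close> products and iterates
  of tensor product intertwining operators converge and that the associativity isomorphism maps
  \<open>\<Y>(w1,e\<^bsup>ln r1\<^esup>)\<Y>(w2,e\<^bsup>ln r2\<^esup>)w3\<close> to \<open>\<Y>(\<Y>(w1,e\<^bsup>ln (r1-r2)\<^esup>)w2,e\<^bsup>ln r2\<^esup>)w3\<close>.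
\<close>

locale vertex_tensor_category =
  vertex_operator_algebra V + module_tensor_data V C
  for V :: "'a::complex_vector_space voa" and C :: "'a tensor_data" +
  assumes obj_module: "X \<in> obj C \<Longrightarrow> generalized_module V X \<and> grading_restricted V X"
    and unit_in: "\<one> \<in> obj C"
    and tensor_product: "X \<in> obj C \<Longrightarrow> Y \<in> obj C \<Longrightarrow>
      Pz_tensor_product V (obj C) 1 X Y (X \<otimes> Y) (box C X Y)"
    \<comment> \<open>the structure isomorphisms\<close>
    and asc_iso: "X \<in> obj C \<Longrightarrow> Y \<in> obj C \<Longrightarrow> Z \<in> obj C \<Longrightarrow>
      asc C X Y Z \<in> iso V (X \<otimes> (Y \<otimes> Z)) ((X \<otimes> Y) \<otimes> Z)"
    and lun_iso: "X \<in> obj C \<Longrightarrow> lun C X \<in> iso V (\<one> \<otimes> X) X"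
    and run_iso: "X \<in> obj C \<Longrightarrow> run C X \<in> iso V (X \<otimes> \<one>) X"
    and brd_iso: "X \<in> obj C \<Longrightarrow> Y \<in> obj C \<Longrightarrow> brd C X Y \<in> iso V (X \<otimes> Y) (Y \<otimes> X)"
    and asc_char: "X \<in> obj C \<Longrightarrow> Y \<in> obj C \<Longrightarrow> Z \<in> obj C \<Longrightarrow>
      w1 \<in> car X \<Longrightarrow> w2 \<in> car Y \<Longrightarrow> w3 \<in> car Z \<Longrightarrow>
      r1 > r2 \<Longrightarrow> r2 > r1 - r2 \<Longrightarrow> r1 - r2 > (0::real) \<Longrightarrow>
      \<exists>F\<in>compl V (X \<otimes> (Y \<otimes> Z)). \<forall>p.
        weak_has_sum (\<lambda>n. tensor_op_at X (Y \<otimes> Z) (complex_of_real (ln r1)) w1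
            (tensor_op_at Y Z (complex_of_real (ln r2)) w2 w3 n) p) (F p) \<and>
        weak_has_sum (\<lambda>n. tensor_op_at (X \<otimes> Y) Z (complex_of_real (ln r2))
            (tensor_op_at X Y (complex_of_real (ln (r1 - r2))) w1 w2 n) w3 p) (app (asc C X Y Z) (F p))"
    and lun_char: "X \<in> obj C \<Longrightarrow> w \<in> car X \<Longrightarrow>
      app (lun C X) (box C \<one> X (vac V) w p) = wt_comp V X w p"
    and run_char: "X \<in> obj C \<Longrightarrow> w \<in> car X \<Longrightarrow>
      app (run C X) (box C X \<one> w (vac V) p) = exp_Lm1 V X (wt_comp V X w) p"
    and brd_char: "X \<in> obj C \<Longrightarrow> Y \<in> obj C \<Longrightarrow> x \<in> car X \<Longrightarrow> y \<in> car Y \<Longrightarrow>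
      app (brd C X Y) (box C X Y x y p) =
        exp_Lm1 V (Y \<otimes> X) (tensor_op_at Y X (pi * \<i>) y x) p"
    \<comment> \<open>naturality\<close>
    and asc_natural: "X \<in> obj C \<Longrightarrow> X' \<in> obj C \<Longrightarrow> Y \<in> obj C \<Longrightarrow> Y' \<in> obj C \<Longrightarrow>
      Z \<in> obj C \<Longrightarrow> Z' \<in> obj C \<Longrightarrow>
      f \<in> hom V X X' \<Longrightarrow> g \<in> hom V Y Y' \<Longrightarrow> h \<in> hom V Z Z' \<Longrightarrow>
      asc C X' Y' Z' \<cdot> (f \<otimes>\<^sub>a (g \<otimes>\<^sub>a h)) = ((f \<otimes>\<^sub>a g) \<otimes>\<^sub>a h) \<cdot> asc C X Y Z"
    and lun_natural: "X \<in> obj C \<Longrightarrow> X' \<in> obj C \<Longrightarrow> f \<in> hom V X X' \<Longrightarrow>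
      lun C X' \<cdot> (id_arr \<one> \<otimes>\<^sub>a f) = f \<cdot> lun C X"
    and run_natural: "X \<in> obj C \<Longrightarrow> X' \<in> obj C \<Longrightarrow> f \<in> hom V X X' \<Longrightarrow>
      run C X' \<cdot> (f \<otimes>\<^sub>a id_arr \<one>) = f \<cdot> run C X"
    and brd_natural: "X \<in> obj C \<Longrightarrow> X' \<in> obj C \<Longrightarrow> Y \<in> obj C \<Longrightarrow> Y' \<in> obj C \<Longrightarrow>
      f \<in> hom V X X' \<Longrightarrow> g \<in> hom V Y Y' \<Longrightarrow>
      brd C X' Y' \<cdot> (f \<otimes>\<^sub>a g) = (g \<otimes>\<^sub>a f) \<cdot> brd C X Y"
    \<comment> \<open>coherence\<close>
    and triangle: "X \<in> obj C \<Longrightarrow> Y \<in> obj C \<Longrightarrow>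
      (run C X \<otimes>\<^sub>a id_arr Y) \<cdot> asc C X \<one> Y = id_arr X \<otimes>\<^sub>a lun C Y"
    and pentagon: "W \<in> obj C \<Longrightarrow> X \<in> obj C \<Longrightarrow> Y \<in> obj C \<Longrightarrow> Z \<in> obj C \<Longrightarrow>
      asc C (W \<otimes> X) Y Z \<cdot> asc C W X (Y \<otimes> Z) =
      (asc C W X Y \<otimes>\<^sub>a id_arr Z) \<cdot> asc C W (X \<otimes> Y) Z \<cdot> (id_arr W \<otimes>\<^sub>a asc C X Y Z)"
    and hexagon1: "X \<in> obj C \<Longrightarrow> Y \<in> obj C \<Longrightarrow> Z \<in> obj C \<Longrightarrow>
      brd C X (Y \<otimes> Z) =
      asc C Y Z X \<cdot> (id_arr Y \<otimes>\<^sub>a brd C X Z) \<cdot> inv_arr V (asc C Y X Z)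
        \<cdot> (brd C X Y \<otimes>\<^sub>a id_arr Z) \<cdot> asc C X Y Z"
    and hexagon2: "X \<in> obj C \<Longrightarrow> Y \<in> obj C \<Longrightarrow> Z \<in> obj C \<Longrightarrow>
      brd C (X \<otimes> Y) Z =
      inv_arr V (asc C Z X Y) \<cdot> (brd C X Z \<otimes>\<^sub>a id_arr Y) \<cdot> asc C X Z Y
        \<cdot> (id_arr X \<otimes>\<^sub>a brd C Y Z) \<cdot> inv_arr V (asc C X Y Z)"


section \<open>Ribbon structures and traces\<close>

text \<open>Chosen left duals \<open>X\<^sup>\<or>\<close> with \<open>X\<^sup>\<or> \<otimes> X \<rightarrow> \<one> \<rightarrow> X \<otimes> X\<^sup>\<or>\<close>, and a pivotal structure \<open>X \<rightarrow> X\<^sup>\<or>\<^sup>\<or>\<close>.\<close>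

record 'a ribbon_data =
  dual :: "'a vmod \<Rightarrow> 'a vmod"
  ev :: "'a vmod \<Rightarrow> 'a arr"
  coev :: "'a vmod \<Rightarrow> 'a arr"
  piv :: "'a vmod \<Rightarrow> 'a arr"

definition (in module_tensor_data) left_dual :: "'a vmod \<Rightarrow> 'a vmod \<Rightarrow> 'a arr \<Rightarrow> 'a arr \<Rightarrow> bool" where
  "left_dual X D e i \<longleftrightarrow>
     D \<in> obj C \<and> e \<in> hom V (D \<otimes> X) \<one> \<and> i \<in> hom V \<one> (X \<otimes> D) \<and>
     run C X \<cdot> (id_arr X \<otimes>\<^sub>a e) \<cdot> inv_arr V (asc C X D X) \<cdot> (i \<otimes>\<^sub>a id_arr X)
       \<cdot> inv_arr V (lun C X) = id_arr X \<and>
     lun C D \<cdot> (e \<otimes>\<^sub>a id_arr D) \<cdot> asc C D X D \<cdot> (id_arr D \<otimes>\<^sub>a i)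
       \<cdot> inv_arr V (run C D) = id_arr D"

locale module_ribbon_data = module_tensor_data V C
  for V :: "'a::complex_vector_space voa" and C :: "'a tensor_data" +
  fixes R :: "'a ribbon_data"
begin

abbreviation dual_obj :: "'a vmod \<Rightarrow> 'a vmod"  ("_\<^sup>\<or>" [1000] 1000) where
  "X\<^sup>\<or> \<equiv> dual R X"

text \<open>The morphism \<open>D \<rightarrow> Z\<^sup>\<or>\<close> corresponding to a pairing \<open>p : D \<otimes> Z \<rightarrow> \<one>\<close>.\<close>

definition mate :: "'a vmod \<Rightarrow> 'a vmod \<Rightarrow> 'a arr \<Rightarrow> 'a arr" where
  "mate D Z p = lun C (Z\<^sup>\<or>) \<cdot> (p \<otimes>\<^sub>a id_arr (Z\<^sup>\<or>)) \<cdot> asc C D Z (Z\<^sup>\<or>)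
     \<cdot> (id_arr D \<otimes>\<^sub>a coev R Z) \<cdot> inv_arr V (run C D)"

definition dual_arr :: "'a arr \<Rightarrow> 'a arr" where
  "dual_arr f = mate ((tgt f)\<^sup>\<or>) (src f) (ev R (tgt f) \<cdot> (id_arr ((tgt f)\<^sup>\<or>) \<otimes>\<^sub>a f))"

text \<open>The canonical isomorphism \<open>Y\<^sup>\<or> \<otimes> X\<^sup>\<or> \<rightarrow> (X \<otimes> Y)\<^sup>\<or>\<close>.\<close>

definition dual_tensor :: "'a vmod \<Rightarrow> 'a vmod \<Rightarrow> 'a arr" where
  "dual_tensor X Y = mate (Y\<^sup>\<or> \<otimes> X\<^sup>\<or>) (X \<otimes> Y)
     (ev R Y \<cdot> (id_arr (Y\<^sup>\<or>) \<otimes>\<^sub>a (lun C Y \<cdot> (ev R X \<otimes>\<^sub>a id_arr Y) \<cdot> asc C (X\<^sup>\<or>) X Y))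
        \<cdot> inv_arr V (asc C (Y\<^sup>\<or>) (X\<^sup>\<or>) (X \<otimes> Y)))"

text \<open>The Drinfeld isomorphism \<open>X \<rightarrow> X \<otimes> X\<^sup>\<or> \<otimes> X\<^sup>\<or>\<^sup>\<or> \<rightarrow> X\<^sup>\<or> \<otimes> X \<otimes> X\<^sup>\<or>\<^sup>\<or> \<rightarrow> X\<^sup>\<or>\<^sup>\<or>\<close>.\<close>

definition drinfeld :: "'a vmod \<Rightarrow> 'a arr" where
  "drinfeld X = mate X (X\<^sup>\<or>) (ev R X \<cdot> brd C X (X\<^sup>\<or>))"

definition trace1 :: "'a arr \<Rightarrow> 'a arr" where
  "trace1 f = (let X = src f in
     ev R (X\<^sup>\<or>) \<cdot> ((piv R X \<cdot> f) \<otimes>\<^sub>a id_arr (X\<^sup>\<or>)) \<cdot> coev R X)"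

definition trace2 :: "'a arr \<Rightarrow> 'a arr" where
  "trace2 f = (let X = src f in
     ev R X \<cdot> (id_arr (X\<^sup>\<or>) \<otimes>\<^sub>a (f \<cdot> inv_arr V (piv R X))) \<cdot> coev R (X\<^sup>\<or>))"

definition qdim :: "'a vmod \<Rightarrow> complex" where
  "qdim X = scalar_of (trace1 (id_arr X))"

end

text \<open>Ribbon: rigid, pivotal with associated twist \<open>e\<^bsup>2\<pi>iL(0)\<^esup>\<close>, and the two traces coincide.\<close>

locale ribbon_vertex_tensor_category =
  vertex_tensor_category V C + module_ribbon_data V C R
  for V :: "'a::complex_vector_space voa" and C :: "'a tensor_data" and R :: "'a ribbon_data" +
  assumes has_left_dual: "X \<in> obj C \<Longrightarrow> left_dual X (X\<^sup>\<or>) (ev R X) (coev R X)"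
    and has_right_dual: "X \<in> obj C \<Longrightarrow> \<exists>D\<in>obj C. \<exists>e i. left_dual D X e i"
    and piv_iso: "X \<in> obj C \<Longrightarrow> piv R X \<in> iso V X (X\<^sup>\<or>\<^sup>\<or>)"
    and piv_natural: "X \<in> obj C \<Longrightarrow> Y \<in> obj C \<Longrightarrow> f \<in> hom V X Y \<Longrightarrow>
      piv R Y \<cdot> f = dual_arr (dual_arr f) \<cdot> piv R X"
    and piv_monoidal: "X \<in> obj C \<Longrightarrow> Y \<in> obj C \<Longrightarrow>
      dual_arr (dual_tensor X Y) \<cdot> piv R (X \<otimes> Y) =
      dual_tensor (Y\<^sup>\<or>) (X\<^sup>\<or>) \<cdot> (piv R X \<otimes>\<^sub>a piv R Y)"
    and piv_twist: "X \<in> obj C \<Longrightarrow> piv R X = drinfeld X \<cdot> twist V X"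
    and traces_coincide: "X \<in> obj C \<Longrightarrow> f \<in> hom V X X \<Longrightarrow> trace1 f = trace2 f"

end

theory Submission
  imports Defs "HOL-Computational_Algebra.Fundamental_Theorem_Algebra"
begin

text \<open>
  Since \<open>L(0)\<close> acts on the irreducible module \<open>J\<close> diagonalisably with weights in \<open>h\<^sub>J + \<int>\<close>, the twist
  of \<open>J\<close> is the scalar \<open>e\<^bsup>2\<pi>ih\<^esup>\<close>.  Writing the pivotal structure as Drinfeld isomorphism times twist,
  the quantum dimension is \<open>e\<^bsup>2\<pi>ih\<^esup> q\<close> with \<open>q = ev \<circ> c\<^bsub>J,D\<^esub> \<circ> coev\<close>, where \<open>D\<close> is the dual of \<open>J\<close>.
  It remains to see that \<open>c\<^bsub>J,J\<^esub> q = 1\<close>: by the hexagon, \<open>c\<^bsub>J,J\<^esub>\<close> followed by \<open>c\<^bsub>J,D\<^esub>\<close> is the braiding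
  of \<open>J\<close> with \<open>J \<otimes> D\<close>, and naturality against the coevaluation reduces it to a zigzag.
\<close>

section \<open>Morphisms of generalized modules\<close>

text \<open>\<open>braiding_scalar\<close> and \<open>qdim\<close> are read off by
  \<open>scalar_of\<close>, a definite description, so the arrows concerned must first be shown to
  be scalars on nonzero objects. V is not assumed simple, so scalarity of the endomorphisms of the
  unit has to be derived. Schur's lemma is proved for J and carried over: an endomorphism f of the
  unit makes id_J \<otimes> f a scalar, hence also its action on (J \<otimes> J) \<otimes> 1, and J
  \<otimes> J is isomorphic to the unit. Conjugation by that isomorphism makes c_{J,J} an
  endomorphism of the unit as well, so one fact covers both the braiding and q.

  The category is not strict, so each move of a string diagram costs associators and unit
  isomorphisms. The compatibilities needed, among them that of the braiding with the unit, are
  derived from the triangle, pentagon and hexagon.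

  Modules are only generalized, so L(0) may a priori have a nilpotent part. Irreducibility removes
  it: the true eigenspaces for one coset h + Z already span a nonzero submodule.\<close>

lemma arr_comp_simps [simp]:
  "src (g \<cdot> f) = src f" "tgt (g \<cdot> f) = tgt g" "app (g \<cdot> f) x = app g (app f x)"
  by (simp_all add: arr_comp_def)

lemma arr_comp_assoc: "(h \<cdot> g) \<cdot> f = h \<cdot> (g \<cdot> f)"
  by (simp add: arr_comp_def comp_assoc)

text \<open>Composites are nested to the right, so an equation of two-fold composites needs this
  form to rewrite the head of a longer chain.\<close>

lemma arr_comp_congL: "g \<cdot> f = g' \<cdot> f' \<Longrightarrow> g \<cdot> f \<cdot> h = g' \<cdot> f' \<cdot> h"
  by (metis arr_comp_assoc)

lemma id_arr_simps [simp]: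
  "src (id_arr X) = X" "tgt (id_arr X) = X" "x \<in> car X \<Longrightarrow> app (id_arr X) x = x"
  by (simp_all add: id_arr_def)

lemma scale_arr_simps [simp]:
  "src (scale_arr c f) = src f" "tgt (scale_arr c f) = tgt f" "app (scale_arr c f) x = c *\<^sub>C app f x"
  by (simp_all add: scale_arr_def)

lemma scale_arr_one [simp]: "scale_arr 1 f = f"
  by (simp add: scale_arr_def)

lemma scale_arr_scale_arr [simp]: "scale_arr c (scale_arr d f) = scale_arr (c * d) f"
  by (simp add: scale_arr_def)

lemma scale_arr_comp [simp]: "scale_arr c g \<cdot> f = scale_arr c (g \<cdot> f)"
  by (simp add: scale_arr_def arr_comp_def comp_def)

lemma arr_eqI: "src f = src g \<Longrightarrow> tgt f = tgt g \<Longrightarrow> (\<And>x. app f x = app g x) \<Longrightarrow> f = (g :: 'a arr)"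
  by (cases f; cases g) auto

lemma homD:
  assumes "f \<in> hom V X Y"
  shows "src f = X" "tgt f = Y" "linear_on (car X) (car Y) (app f)"
    "v \<in> car (adj V) \<Longrightarrow> w \<in> car X \<Longrightarrow> app f (act X v n w) = act Y v n (app f w)"
    "x \<notin> car X \<Longrightarrow> app f x = 0"
    "x \<in> car X \<Longrightarrow> app f x \<in> car Y"
    "x \<in> car X \<Longrightarrow> y \<in> car X \<Longrightarrow> app f (x + y) = app f x + app f y"
    "x \<in> car X \<Longrightarrow> app f (c *\<^sub>C x) = c *\<^sub>C app f x"
  using assms by (auto simp: hom_def linear_on_def)

lemma hom_zero: "f \<in> hom V X Y \<Longrightarrow> app f 0 = 0"
  using homD(5)[of f V X Y 0] homD(8)[of f V X Y 0 0] by (cases "0 \<in> car X") auto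

lemma hom_eqI:
  assumes "f \<in> hom V X Y" "g \<in> hom V X Y" "\<And>x. x \<in> car X \<Longrightarrow> app f x = app g x"
  shows "f = g"
proof (rule arr_eqI)
  show "app f x = app g x" for x
    using assms homD(5)[OF assms(1)] homD(5)[OF assms(2)] by (cases "x \<in> car X") auto
qed (use assms homD in metis)+

text \<open>The composite must again vanish off the carrier of its source; \<open>f\<close> gives 0
  there, and \<open>hom_zero\<close> carries this through \<open>g\<close>.\<close>

lemma hom_comp: "f \<in> hom V X Y \<Longrightarrow> g \<in> hom V Y Z \<Longrightarrow> g \<cdot> f \<in> hom V X Z"
  unfolding hom_def linear_on_def arr_comp_def
  using hom_zero[of g V Y Z] by (auto simp: hom_def linear_on_def)

lemma hom_scale_comp:
  assumes "f \<in> hom V X Y" "g \<in> hom V Y Z"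
  shows "g \<cdot> scale_arr c f = scale_arr c (g \<cdot> f)"
proof (rule arr_eqI)
  show "app (g \<cdot> scale_arr c f) x = app (scale_arr c (g \<cdot> f)) x" for x
    using homD[OF assms(1)] homD[OF assms(2)] hom_zero[OF assms(2)] by (cases "x \<in> car X") auto
qed auto

lemma id_arr_comp: "f \<in> hom V X Y \<Longrightarrow> id_arr Y \<cdot> f = f"
  by (rule arr_eqI) (auto simp: id_arr_def arr_comp_def hom_def linear_on_def; metis)+

lemma comp_id_arr: "f \<in> hom V X Y \<Longrightarrow> f \<cdot> id_arr X = f"
  using hom_zero[of f V X Y]
  by (intro arr_eqI) (auto simp: id_arr_def arr_comp_def hom_def)

lemma module_car:
  assumes "generalized_module V M"
  shows "0 \<in> car M" "x \<in> car M \<Longrightarrow> y \<in> car M \<Longrightarrow> x + y \<in> car M"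
    "x \<in> car M \<Longrightarrow> c *\<^sub>C x \<in> car M"
    "v \<in> car (adj V) \<Longrightarrow> x \<in> car M \<Longrightarrow> act M v n x \<in> car M"
    "v \<in> car (adj V) \<Longrightarrow> x \<in> car M \<Longrightarrow> y \<in> car M \<Longrightarrow> act M v n (x + y) = act M v n x + act M v n y"
    "v \<in> car (adj V) \<Longrightarrow> x \<in> car M \<Longrightarrow> act M v n (c *\<^sub>C x) = c *\<^sub>C act M v n x"
    "v \<in> car (adj V) \<Longrightarrow> u \<in> car (adj V) \<Longrightarrow> x \<in> car M \<Longrightarrow> act M (v + u) n x = act M v n x + act M u n x"
    "v \<in> car (adj V) \<Longrightarrow> x \<in> car M \<Longrightarrow> act M (c *\<^sub>C v) n x = c *\<^sub>C act M v n x"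
  using assms[unfolded generalized_module_def, THEN conjunct1]
    assms[unfolded generalized_module_def, THEN conjunct2, THEN conjunct1]
  by (simp_all add: bilinear_on_def linear_on_def cvs.subspace_def)

lemma id_arr_hom: "generalized_module V X \<Longrightarrow> id_arr X \<in> hom V X X"
  using module_car[of V X] by (auto simp: hom_def linear_on_def id_arr_def)

lemma scale_arr_hom:
  assumes "generalized_module V Y" "f \<in> hom V X Y"
  shows "scale_arr c f \<in> hom V X Y"
  using homD[OF assms(2)] module_car[OF assms(1)]
  by (auto simp: hom_def linear_on_def scaleC_add_right cvs.scale_left_commute)

lemma is_inverse_unique:
  assumes "f \<in> hom V X Y" "is_inverse V f g" "is_inverse V f h"
  shows "g = h"
proof -
  have s: "src f = X" "tgt f = Y" using assms(1) homD by auto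
  have gh: "g \<in> hom V Y X" "h \<in> hom V Y X" "g \<cdot> f = id_arr X" "f \<cdot> h = id_arr Y"
    using assms s by (auto simp: is_inverse_def)
  have "g = g \<cdot> (f \<cdot> h)" using gh comp_id_arr by metis
  also have "\<dots> = h" using gh id_arr_comp by (metis arr_comp_assoc)
  finally show ?thesis .
qed

lemma inv_arr_eqI:
  assumes "f \<in> hom V X Y" "is_inverse V f g"
  shows "inv_arr V f = g"
  unfolding inv_arr_def using is_inverse_unique[OF assms(1)] assms(2) by blast

lemma iso_inv:
  assumes "f \<in> iso V X Y"
  shows "inv_arr V f \<in> hom V Y X" "inv_arr V f \<cdot> f = id_arr X" "f \<cdot> inv_arr V f = id_arr Y"
proof -
  obtain g where g: "is_inverse V f g" and f: "f \<in> hom V X Y"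
    using assms by (auto simp: iso_def)
  have "src f = X" "tgt f = Y" using f homD by auto
  then show "inv_arr V f \<in> hom V Y X" "inv_arr V f \<cdot> f = id_arr X" "f \<cdot> inv_arr V f = id_arr Y"
    using g inv_arr_eqI[OF f g] by (auto simp: is_inverse_def)
qed

text \<open>A nonzero vector is what makes the description in \<open>scalar_of\<close> unique; on
  the zero module every scalar would do.\<close>

lemma scalar_of_scale_id:
  assumes "x \<in> car X" "x \<noteq> 0"
  shows "scalar_of (scale_arr c (id_arr X)) = c"
  unfolding scalar_of_def
proof (rule the_equality)
  fix d assume "scale_arr c (id_arr X) = scale_arr d (id_arr (src (scale_arr c (id_arr X))))"
  then have "app (scale_arr c (id_arr X)) x = app (scale_arr d (id_arr X)) x" by simp
  then show "d = c" using assms by simp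
qed simp

section \<open>The tensor category\<close>

context vertex_tensor_category
begin

text \<open>Reading the endpoints off the arrow, instead of naming them as in \<open>hom\<close>,
  lets the simplifier check composability by computing \<open>src\<close> and
  \<open>tgt\<close>.\<close>

definition mor :: "'a arr \<Rightarrow> bool" where
  "mor f \<longleftrightarrow> src f \<in> obj C \<and> tgt f \<in> obj C \<and> f \<in> hom V (src f) (tgt f)"

lemma morI: "f \<in> hom V X Y \<Longrightarrow> X \<in> obj C \<Longrightarrow> Y \<in> obj C \<Longrightarrow> mor f \<and> src f = X \<and> tgt f = Y"
  using homD(1,2)[of f V X Y] by (auto simp: mor_def)

lemma mor_obj [simp]: "mor f \<Longrightarrow> src f \<in> obj C" "mor f \<Longrightarrow> tgt f \<in> obj C"
  by (auto simp: mor_def)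

lemma mor_hom: "mor f \<Longrightarrow> src f = X \<Longrightarrow> tgt f = Y \<Longrightarrow> f \<in> hom V X Y"
  by (auto simp: mor_def simp del: mor_obj)

lemma mor_comp [simp]: "mor f \<Longrightarrow> mor g \<Longrightarrow> tgt f = src g \<Longrightarrow> mor (g \<cdot> f)"
  using hom_comp[of f V "src f" "tgt f" g "tgt g"] by (simp add: mor_def del: mor_obj)

lemma mor_id [simp]: "X \<in> obj C \<Longrightarrow> mor (id_arr X)"
  using obj_module id_arr_hom by (auto simp: mor_def simp del: mor_obj)

lemma mor_scale [simp]: "mor f \<Longrightarrow> mor (scale_arr c f)"
  using obj_module scale_arr_hom[of V "tgt f" f "src f" c] by (auto simp: mor_def simp del: mor_obj)

lemma mor_id_left [simp]: "mor f \<Longrightarrow> tgt f = X \<Longrightarrow> id_arr X \<cdot> f = f"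
  using id_arr_comp[of f V "src f" "tgt f"] by (simp add: mor_def del: mor_obj)

lemma mor_id_right [simp]: "mor f \<Longrightarrow> src f = X \<Longrightarrow> f \<cdot> id_arr X = f"
  using comp_id_arr[of f V "src f" "tgt f"] by (simp add: mor_def del: mor_obj)

lemma mor_comp_scale [simp]: "mor f \<Longrightarrow> mor g \<Longrightarrow> tgt f = src g \<Longrightarrow> g \<cdot> scale_arr c f = scale_arr c (g \<cdot> f)"
  unfolding mor_def using hom_scale_comp[of f V "src f" "tgt f" g "tgt g" c] by auto

definition invertible_arr :: "'a arr \<Rightarrow> bool" where
  "invertible_arr f \<longleftrightarrow> mor f \<and> f \<in> iso V (src f) (tgt f)"

lemma invertible_arrI: "f \<in> iso V X Y \<Longrightarrow> X \<in> obj C \<Longrightarrow> Y \<in> obj C \<Longrightarrow> invertible_arr f \<and> src f = X \<and> tgt f = Y"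
  using morI[of f X Y] by (auto simp: invertible_arr_def iso_def)

lemma invertible_mor [simp]: "invertible_arr f \<Longrightarrow> mor f"
  by (simp add: invertible_arr_def)

lemma inv_arr_mor [simp]:
  assumes "invertible_arr f"
  shows "mor (inv_arr V f)" "src (inv_arr V f) = tgt f" "tgt (inv_arr V f) = src f"
  using iso_inv(1)[of f V "src f" "tgt f"] assms morI mor_obj by (auto simp: invertible_arr_def)

lemma inv_arr_comp [simp]:
  assumes "invertible_arr f"
  shows "inv_arr V f \<cdot> f = id_arr (src f)" "f \<cdot> inv_arr V f = id_arr (tgt f)"
  using iso_inv(2,3)[of f V "src f" "tgt f"] assms by (auto simp: invertible_arr_def)

lemma inv_arr_comp_assoc [simp]:
  assumes "invertible_arr f" "mor h"
  shows "tgt h = src f \<Longrightarrow> inv_arr V f \<cdot> f \<cdot> h = h"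
    "tgt h = tgt f \<Longrightarrow> f \<cdot> inv_arr V f \<cdot> h = h"
  using assms by (simp_all flip: arr_comp_assoc)

lemma cancel_left:
  assumes "invertible_arr f" "mor g" "mor h" "tgt g = src f" "tgt h = src f" "f \<cdot> g = f \<cdot> h"
  shows "g = h"
  using assms inv_arr_comp_assoc(1)[of f g] inv_arr_comp_assoc(1)[of f h] by metis

lemma cancel_right:
  assumes "invertible_arr f" "mor g" "mor h" "src g = tgt f" "src h = tgt f" "g \<cdot> f = h \<cdot> f"
  shows "g = h"
proof -
  have "(g \<cdot> f) \<cdot> inv_arr V f = (h \<cdot> f) \<cdot> inv_arr V f" using assms(6) by simp
  then show ?thesis using assms(1-5) by (simp add: arr_comp_assoc)
qed

section \<open>Bifunctoriality of the tensor product\<close>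

lemma tensor_obj [simp]: "X \<in> obj C \<Longrightarrow> Y \<in> obj C \<Longrightarrow> X \<otimes> Y \<in> obj C"
  using tensor_product by (auto simp: Pz_tensor_product_def)

lemma unit_obj [simp]: "\<one> \<in> obj C"
  by (rule unit_in)

lemma box_intertwining:
  "X \<in> obj C \<Longrightarrow> Y \<in> obj C \<Longrightarrow> intertwining_map V 1 X Y (X \<otimes> Y) (box C X Y)"
  using tensor_product by (auto simp: Pz_tensor_product_def)

lemma box_scale:
  assumes "X \<in> obj C" "Y \<in> obj C" "x \<in> car X" "y \<in> car Y"
  shows "box C X Y (c *\<^sub>C x) y p = c *\<^sub>C box C X Y x y p"
    "box C X Y x (c *\<^sub>C y) p = c *\<^sub>C box C X Y x y p"
    "box C X Y x y p \<in> car (X \<otimes> Y)"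
  using box_intertwining[OF assms(1,2)] assms(3,4)
  by (auto simp: intertwining_map_def bilinear_on_def linear_on_def gwt_def)

lemma box_universal:
  assumes "X \<in> obj C" "Y \<in> obj C" "W \<in> obj C" "intertwining_map V 1 X Y W G"
  shows "\<exists>!h. h \<in> hom V (X \<otimes> Y) W \<and>
    (\<forall>x\<in>car X. \<forall>y\<in>car Y. \<forall>p. app h (box C X Y x y p) = G x y p)"
  using tensor_product[OF assms(1,2)] assms(3,4) unfolding Pz_tensor_product_def by blast

text \<open>Homomorphisms commute with all vertex operators, so the Jacobi condition survives
  pulling back along \<open>f\<close> and \<open>g\<close>. Fed into the universal property, this
  yields the tensor product of arrows.\<close>

lemma intertwining_map_comp:
  assumes I: "intertwining_map V z X' Y' W I" and f: "f \<in> hom V X X'" and g: "g \<in> hom V Y Y'"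
  shows "intertwining_map V z X Y W (\<lambda>x y. I (app f x) (app g y))"
proof -
  note homs = homD(4,6-8)[OF f] homD(4,6-8)[OF g]
  show ?thesis
    unfolding intertwining_map_def
  proof (intro conjI ballI allI)
    show "bilinear_on (car X) (car Y) (gwt V W p) (\<lambda>w1 w2. I (app f w1) (app g w2) p)" for p
      using I unfolding intertwining_map_def bilinear_on_def linear_on_def by (auto simp: homs)
  next
    fix w1 w2 p assume "w1 \<in> car X" "w2 \<in> car Y"
    then show "\<exists>N::nat. \<forall>k\<ge>N. I (app f w1) (app g w2) (p - of_nat k) = 0"
      using I unfolding intertwining_map_def by (auto simp: homs)
  next
    fix v w1 w2 p and l m :: int
    assume "v \<in> car \<one>" and w: "w1 \<in> car X" "w2 \<in> car Y"
    then show "Sum_any (\<lambda>i::nat. ((of_int l gchoose i) * (- z) ^ i) *\<^sub>C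
          compl_act V W v (m + l - int i) (I (app f w1) (app g w2)) p)
        = Sum_any (\<lambda>i::nat. ((of_int m gchoose i) * z powi (m - int i)) *\<^sub>C
            I (app f (act X v (l + int i) w1)) (app g w2) p)
        + Sum_any (\<lambda>i::nat. ((-1) powi l * (-1) ^ i * (of_int l gchoose i)
              * z powi (l - int i)) *\<^sub>C
            I (app f w1) (app g (act Y v (m + int i) w2)) p)"
      using I unfolding intertwining_map_def by (simp add: homs)
  qed
qed

lemma tensor_arr_ex1:
  assumes "mor f" "mor g"
  shows "\<exists>!h. h \<in> hom V (src f \<otimes> src g) (tgt f \<otimes> tgt g) \<and>
     (\<forall>x\<in>car (src f). \<forall>y\<in>car (src g). \<forall>p.
        app h (box C (src f) (src g) x y p) = box C (tgt f) (tgt g) (app f x) (app g y) p)"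
  using assms
    intertwining_map_comp[of 1 "tgt f" "tgt g" "tgt f \<otimes> tgt g" "box C (tgt f) (tgt g)" f "src f" g "src g"]
  by (intro box_universal) (auto simp: mor_def box_intertwining simp del: mor_obj)

lemma tensor_arr_spec:
  assumes "mor f" "mor g"
  shows "f \<otimes>\<^sub>a g \<in> hom V (src f \<otimes> src g) (tgt f \<otimes> tgt g)"
    "x \<in> car (src f) \<Longrightarrow> y \<in> car (src g) \<Longrightarrow>
       app (f \<otimes>\<^sub>a g) (box C (src f) (src g) x y p) = box C (tgt f) (tgt g) (app f x) (app g y) p"
  using theI'[OF tensor_arr_ex1[OF assms]] unfolding tensor_arr_def by blast+

text \<open>The uniqueness half of the universal property: arrows out of a tensor product are
  compared on the values of \<open>box\<close> alone. The functor laws below all come from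
  it.\<close>

lemma tensor_arr_eqI:
  assumes "mor f" "mor g" "mor h" "src h = src f \<otimes> src g" "tgt h = tgt f \<otimes> tgt g"
    "\<And>x y p. x \<in> car (src f) \<Longrightarrow> y \<in> car (src g) \<Longrightarrow>
        app h (box C (src f) (src g) x y p) = box C (tgt f) (tgt g) (app f x) (app g y) p"
  shows "f \<otimes>\<^sub>a g = h"
  using tensor_arr_ex1[OF assms(1,2)] tensor_arr_spec[OF assms(1,2)] assms(3-6)
  unfolding mor_def by metis

lemma tensor_arr_mor [simp]:
  assumes "mor f" "mor g"
  shows "mor (f \<otimes>\<^sub>a g)" "src (f \<otimes>\<^sub>a g) = src f \<otimes> src g" "tgt (f \<otimes>\<^sub>a g) = tgt f \<otimes> tgt g"
  using morI[OF tensor_arr_spec(1)[OF assms]] assms by auto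

lemma mor_app: "mor f \<Longrightarrow> x \<in> car (src f) \<Longrightarrow> app f x \<in> car (tgt f)"
  using homD(6) by (auto simp: mor_def simp del: mor_obj)

lemma tensor_arr_id [simp]: "X \<in> obj C \<Longrightarrow> Y \<in> obj C \<Longrightarrow> id_arr X \<otimes>\<^sub>a id_arr Y = id_arr (X \<otimes> Y)"
  by (rule tensor_arr_eqI) (auto simp: box_scale)

lemma tensor_arr_comp [simp]:
  assumes "mor f" "mor f'" "mor g" "mor g'" "tgt f = src g" "tgt f' = src g'"
  shows "(g \<otimes>\<^sub>a g') \<cdot> (f \<otimes>\<^sub>a f') = (g \<cdot> f) \<otimes>\<^sub>a (g' \<cdot> f')"
  using assms tensor_arr_spec(2)[of f f'] tensor_arr_spec(2)[of g g'] mor_app[of f] mor_app[of f']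
  by (intro tensor_arr_eqI[symmetric]) auto

lemma tensor_arr_comp_assoc [simp]:
  assumes "mor f" "mor f'" "mor g" "mor g'" "tgt f = src g" "tgt f' = src g'"
  shows "(g \<otimes>\<^sub>a g') \<cdot> (f \<otimes>\<^sub>a f') \<cdot> h = ((g \<cdot> f) \<otimes>\<^sub>a (g' \<cdot> f')) \<cdot> h"
  using tensor_arr_comp[OF assms] by (metis arr_comp_assoc)

lemma tensor_arr_scale [simp]:
  assumes "mor f" "mor g"
  shows "scale_arr c f \<otimes>\<^sub>a g = scale_arr c (f \<otimes>\<^sub>a g)" "f \<otimes>\<^sub>a scale_arr c g = scale_arr c (f \<otimes>\<^sub>a g)"
  using assms tensor_arr_spec(2)[of f g] mor_app[of f] mor_app[of g]
  by (auto intro!: tensor_arr_eqI simp: box_scale)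

lemma is_inverse_invertible:
  assumes "mor f" "mor g" "src g = tgt f" "tgt g = src f" "g \<cdot> f = id_arr (src f)" "f \<cdot> g = id_arr (tgt f)"
  shows "invertible_arr f" "inv_arr V f = g"
proof -
  have *: "is_inverse V f g" using assms by (auto simp: is_inverse_def mor_def simp del: mor_obj)
  then show "invertible_arr f" "inv_arr V f = g"
    using assms(1) inv_arr_eqI[of f V "src f" "tgt f" g] by (auto simp: invertible_arr_def iso_def mor_def simp del: mor_obj)
qed

lemma tensor_arr_invertible [simp]:
  assumes "invertible_arr f" "invertible_arr g"
  shows "invertible_arr (f \<otimes>\<^sub>a g)" "inv_arr V (f \<otimes>\<^sub>a g) = inv_arr V f \<otimes>\<^sub>a inv_arr V g"
  using is_inverse_invertible[of "f \<otimes>\<^sub>a g" "inv_arr V f \<otimes>\<^sub>a inv_arr V g"] assms by auto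

lemma invertible_id [simp]: "X \<in> obj C \<Longrightarrow> invertible_arr (id_arr X)" "X \<in> obj C \<Longrightarrow> inv_arr V (id_arr X) = id_arr X"
  using is_inverse_invertible[of "id_arr X" "id_arr X"] by auto

lemma invertible_comp [simp]:
  assumes "invertible_arr f" "invertible_arr g" "tgt f = src g"
  shows "invertible_arr (g \<cdot> f)"
  by (rule is_inverse_invertible(1)[of "g \<cdot> f" "inv_arr V f \<cdot> inv_arr V g"])
    (use assms in \<open>auto simp: arr_comp_assoc\<close>)

lemma asc_simps [simp]:
  assumes "X \<in> obj C" "Y \<in> obj C" "Z \<in> obj C"
  shows "invertible_arr (asc C X Y Z)" "src (asc C X Y Z) = X \<otimes> (Y \<otimes> Z)"
    "tgt (asc C X Y Z) = (X \<otimes> Y) \<otimes> Z"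
  using invertible_arrI[OF asc_iso[OF assms]] assms by auto

lemma lun_simps [simp]:
  assumes "X \<in> obj C"
  shows "invertible_arr (lun C X)" "src (lun C X) = \<one> \<otimes> X" "tgt (lun C X) = X"
  using invertible_arrI[OF lun_iso[OF assms]] assms by auto

lemma run_simps [simp]:
  assumes "X \<in> obj C"
  shows "invertible_arr (run C X)" "src (run C X) = X \<otimes> \<one>" "tgt (run C X) = X"
  using invertible_arrI[OF run_iso[OF assms]] assms by auto

lemma brd_simps [simp]:
  assumes "X \<in> obj C" "Y \<in> obj C"
  shows "invertible_arr (brd C X Y)" "src (brd C X Y) = X \<otimes> Y" "tgt (brd C X Y) = Y \<otimes> X"
  using invertible_arrI[OF brd_iso[OF assms]] assms by auto

lemma asc_nat:
  assumes "mor f" "mor g" "mor h"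
  shows "asc C (tgt f) (tgt g) (tgt h) \<cdot> (f \<otimes>\<^sub>a (g \<otimes>\<^sub>a h)) =
    ((f \<otimes>\<^sub>a g) \<otimes>\<^sub>a h) \<cdot> asc C (src f) (src g) (src h)"
  using assms by (intro asc_natural) (auto simp: mor_def simp del: mor_obj)

lemma asc_inv_nat:
  assumes "mor f" "mor g" "mor h"
  shows "inv_arr V (asc C (tgt f) (tgt g) (tgt h)) \<cdot> ((f \<otimes>\<^sub>a g) \<otimes>\<^sub>a h) =
    (f \<otimes>\<^sub>a (g \<otimes>\<^sub>a h)) \<cdot> inv_arr V (asc C (src f) (src g) (src h))"
proof -
  have "inv_arr V (asc C (tgt f) (tgt g) (tgt h)) \<cdot> ((f \<otimes>\<^sub>a g) \<otimes>\<^sub>a h) =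
     inv_arr V (asc C (tgt f) (tgt g) (tgt h)) \<cdot> (((f \<otimes>\<^sub>a g) \<otimes>\<^sub>a h) \<cdot> asc C (src f) (src g) (src h))
       \<cdot> inv_arr V (asc C (src f) (src g) (src h))"
    using assms by (simp add: arr_comp_assoc)
  also have "\<dots> = (f \<otimes>\<^sub>a (g \<otimes>\<^sub>a h)) \<cdot> inv_arr V (asc C (src f) (src g) (src h))"
    using assms by (simp add: arr_comp_assoc flip: asc_nat)
  finally show ?thesis .
qed

lemma lun_nat: "mor f \<Longrightarrow> lun C (tgt f) \<cdot> (id_arr \<one> \<otimes>\<^sub>a f) = f \<cdot> lun C (src f)"
  by (intro lun_natural) (auto simp: mor_def simp del: mor_obj)

lemma run_nat: "mor f \<Longrightarrow> run C (tgt f) \<cdot> (f \<otimes>\<^sub>a id_arr \<one>) = f \<cdot> run C (src f)"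
  by (intro run_natural) (auto simp: mor_def simp del: mor_obj)

lemma brd_nat:
  "mor f \<Longrightarrow> mor g \<Longrightarrow> brd C (tgt f) (tgt g) \<cdot> (f \<otimes>\<^sub>a g) = (g \<otimes>\<^sub>a f) \<cdot> brd C (src f) (src g)"
  by (intro brd_natural) (auto simp: mor_def simp del: mor_obj)

section \<open>Unit coherence in a braided monoidal category, after Kelly and Joyal-Street\<close>

lemma unit_tensor_faithful:
  assumes "mor f" "mor g" "src f = src g" "tgt f = tgt g"
  shows "id_arr \<one> \<otimes>\<^sub>a f = id_arr \<one> \<otimes>\<^sub>a g \<Longrightarrow> f = g" "f \<otimes>\<^sub>a id_arr \<one> = g \<otimes>\<^sub>a id_arr \<one> \<Longrightarrow> f = g"
proof -
  assume "id_arr \<one> \<otimes>\<^sub>a f = id_arr \<one> \<otimes>\<^sub>a g"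
  then have "f \<cdot> lun C (src f) = g \<cdot> lun C (src g)" using assms lun_nat by metis
  then show "f = g" using assms by - (rule cancel_right[of "lun C (src f)"], simp_all)
next
  assume "f \<otimes>\<^sub>a id_arr \<one> = g \<otimes>\<^sub>a id_arr \<one>"
  then have "f \<cdot> run C (src f) = g \<cdot> run C (src g)" using assms run_nat by metis
  then show "f = g" using assms by - (rule cancel_right[of "run C (src f)"], simp_all)
qed

text \<open>Kelly's argument: the pentagon for 1, 1, X, Y together with two triangles gives the
  identity after tensoring with the unit on the left, and that tensoring is faithful.\<close>

lemma lun_tensor:
  assumes [simp]: "X \<in> obj C" "Y \<in> obj C"
  shows "(lun C X \<otimes>\<^sub>a id_arr Y) \<cdot> asc C \<one> X Y = lun C (X \<otimes> Y)"
proof -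
  have "asc C \<one> X Y \<cdot> (id_arr \<one> \<otimes>\<^sub>a lun C (X \<otimes> Y))
      = asc C \<one> X Y \<cdot> (run C \<one> \<otimes>\<^sub>a id_arr (X \<otimes> Y)) \<cdot> asc C \<one> \<one> (X \<otimes> Y)"
    by (simp add: triangle)
  also have "\<dots> = ((run C \<one> \<otimes>\<^sub>a id_arr X) \<otimes>\<^sub>a id_arr Y) \<cdot> asc C (\<one> \<otimes> \<one>) X Y \<cdot> asc C \<one> \<one> (X \<otimes> Y)"
    using asc_nat[of "run C \<one>" "id_arr X" "id_arr Y", THEN arr_comp_congL] by simp
  also have "\<dots> = ((run C \<one> \<otimes>\<^sub>a id_arr X) \<otimes>\<^sub>a id_arr Y) \<cdot>
      (asc C \<one> \<one> X \<otimes>\<^sub>a id_arr Y) \<cdot> asc C \<one> (\<one> \<otimes> X) Y \<cdot> (id_arr \<one> \<otimes>\<^sub>a asc C \<one> X Y)"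
    by (simp only: pentagon assms unit_obj)
  also have "\<dots> = ((id_arr \<one> \<otimes>\<^sub>a lun C X) \<otimes>\<^sub>a id_arr Y) \<cdot> asc C \<one> (\<one> \<otimes> X) Y
      \<cdot> (id_arr \<one> \<otimes>\<^sub>a asc C \<one> X Y)"
    by (simp add: triangle)
  also have "\<dots> = asc C \<one> X Y \<cdot> (id_arr \<one> \<otimes>\<^sub>a (lun C X \<otimes>\<^sub>a id_arr Y)) \<cdot> (id_arr \<one> \<otimes>\<^sub>a asc C \<one> X Y)"
    using asc_nat[of "id_arr \<one>" "lun C X" "id_arr Y", THEN arr_comp_congL, of "id_arr \<one> \<otimes>\<^sub>a asc C \<one> X Y"] by simp
  also have "\<dots> = asc C \<one> X Y \<cdot> (id_arr \<one> \<otimes>\<^sub>a ((lun C X \<otimes>\<^sub>a id_arr Y) \<cdot> asc C \<one> X Y))"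
    by simp
  finally have "id_arr \<one> \<otimes>\<^sub>a lun C (X \<otimes> Y) = id_arr \<one> \<otimes>\<^sub>a ((lun C X \<otimes>\<^sub>a id_arr Y) \<cdot> asc C \<one> X Y)"
    by - (rule cancel_left[of "asc C \<one> X Y"], simp_all)
  then show ?thesis by - (rule unit_tensor_faithful(1)[symmetric], simp_all)
qed

text \<open>Naturality of \<open>lun\<close> at \<open>lun C \<one>\<close> itself identifies id
  \<otimes> \<open>lun C \<one>\<close> with \<open>lun C (\<one> \<otimes> \<one>)\<close>;
  \<open>lun_tensor\<close> and the triangle then express the same arrow through \<open>lun\<close>
  and through \<open>run\<close>.\<close>

lemma lun_unit: "lun C \<one> = run C \<one>"
proof -
  have "lun C \<one> \<cdot> (id_arr \<one> \<otimes>\<^sub>a lun C \<one>) = lun C \<one> \<cdot> lun C (\<one> \<otimes> \<one>)"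
    using lun_nat[of "lun C \<one>"] by simp
  then have "id_arr \<one> \<otimes>\<^sub>a lun C \<one> = lun C (\<one> \<otimes> \<one>)"
    by - (rule cancel_left[of "lun C \<one>"], simp_all)
  then have "(lun C \<one> \<otimes>\<^sub>a id_arr \<one>) \<cdot> asc C \<one> \<one> \<one> = (run C \<one> \<otimes>\<^sub>a id_arr \<one>) \<cdot> asc C \<one> \<one> \<one>"
    by (simp add: lun_tensor triangle)
  then have "lun C \<one> \<otimes>\<^sub>a id_arr \<one> = run C \<one> \<otimes>\<^sub>a id_arr \<one>"
    by - (rule cancel_right[of "asc C \<one> \<one> \<one>"], simp_all)
  then show ?thesis by - (rule unit_tensor_faithful(2), simp_all)
qed

text \<open>The mirror image of \<open>lun_tensor\<close>, from the pentagon for X, Y, 1, 1.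
  \<open>?P\<close> is the invertible tail shared by both sides of that pentagon.\<close>

lemma run_tensor:
  assumes [simp]: "X \<in> obj C" "Y \<in> obj C"
  shows "run C (X \<otimes> Y) \<cdot> asc C X Y \<one> = id_arr X \<otimes>\<^sub>a run C Y"
proof -
  let ?P = "asc C X (Y \<otimes> \<one>) \<one> \<cdot> (id_arr X \<otimes>\<^sub>a asc C Y \<one> \<one>)"
  have "((id_arr X \<otimes>\<^sub>a run C Y) \<otimes>\<^sub>a id_arr \<one>) \<cdot> ?P
      = asc C X Y \<one> \<cdot> (id_arr X \<otimes>\<^sub>a (run C Y \<otimes>\<^sub>a id_arr \<one>)) \<cdot> (id_arr X \<otimes>\<^sub>a asc C Y \<one> \<one>)"
    using asc_nat[of "id_arr X" "run C Y" "id_arr \<one>", THEN arr_comp_congL, of "id_arr X \<otimes>\<^sub>a asc C Y \<one> \<one>"] by simp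
  also have "\<dots> = asc C X Y \<one> \<cdot> (id_arr X \<otimes>\<^sub>a (id_arr Y \<otimes>\<^sub>a lun C \<one>))"
    by (simp add: triangle)
  also have "\<dots> = (id_arr (X \<otimes> Y) \<otimes>\<^sub>a lun C \<one>) \<cdot> asc C X Y (\<one> \<otimes> \<one>)"
    using asc_nat[of "id_arr X" "id_arr Y" "lun C \<one>"] by simp
  also have "\<dots> = (run C (X \<otimes> Y) \<otimes>\<^sub>a id_arr \<one>) \<cdot> asc C (X \<otimes> Y) \<one> \<one> \<cdot> asc C X Y (\<one> \<otimes> \<one>)"
    by (simp add: arr_comp_assoc flip: triangle)
  also have "\<dots> = (run C (X \<otimes> Y) \<otimes>\<^sub>a id_arr \<one>) \<cdot> (asc C X Y \<one> \<otimes>\<^sub>a id_arr \<one>) \<cdot> ?P"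
    by (simp only: pentagon assms unit_obj)
  also have "\<dots> = ((run C (X \<otimes> Y) \<cdot> asc C X Y \<one>) \<otimes>\<^sub>a id_arr \<one>) \<cdot> ?P"
    by simp
  finally have "(id_arr X \<otimes>\<^sub>a run C Y) \<otimes>\<^sub>a id_arr \<one> = (run C (X \<otimes> Y) \<cdot> asc C X Y \<one>) \<otimes>\<^sub>a id_arr \<one>"
    by - (rule cancel_right[of ?P], simp_all)
  then show ?thesis by - (rule unit_tensor_faithful(2)[symmetric], simp_all)
qed

text \<open>The hexagon for X, 1, 1 gives an equation in which \<open>?t\<close> occurs once on the
  left and twice on the right. Cancelling one copy leaves \<open>?t\<close> \<otimes> id equal to
  \<open>run C X\<close> \<otimes> id.\<close>

lemma lun_brd:
  assumes [simp]: "X \<in> obj C"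
  shows "lun C X \<cdot> brd C X \<one> = run C X"
proof -
  let ?t = "lun C X \<cdot> brd C X \<one>"
  have t: "invertible_arr ?t" "mor ?t" by simp_all
  let ?Q = "inv_arr V (asc C \<one> X \<one>) \<cdot> (brd C X \<one> \<otimes>\<^sub>a id_arr \<one>) \<cdot> asc C X \<one> \<one>"
  have "?t \<cdot> (id_arr X \<otimes>\<^sub>a run C \<one>) = lun C X \<cdot> (run C \<one> \<otimes>\<^sub>a id_arr X) \<cdot> brd C X (\<one> \<otimes> \<one>)"
    using brd_nat[of "id_arr X" "run C \<one>"] by (simp add: arr_comp_assoc)
  also have "\<dots> = lun C X \<cdot> ((run C \<one> \<otimes>\<^sub>a id_arr X) \<cdot> asc C \<one> \<one> X) \<cdot> (id_arr \<one> \<otimes>\<^sub>a brd C X \<one>) \<cdot> ?Q"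
    by (simp only: hexagon1 assms unit_obj arr_comp_assoc)
  also have "\<dots> = lun C X \<cdot> (id_arr \<one> \<otimes>\<^sub>a ?t) \<cdot> ?Q"
    unfolding triangle[OF unit_obj assms] by simp
  also have "\<dots> = ?t \<cdot> lun C (X \<otimes> \<one>) \<cdot> ?Q"
    using lun_nat[OF t(2), THEN arr_comp_congL, of ?Q] by simp
  finally have "id_arr X \<otimes>\<^sub>a run C \<one> = lun C (X \<otimes> \<one>) \<cdot> ?Q"
    by - (rule cancel_left[OF t(1)], simp_all)
  also have "\<dots> = (?t \<otimes>\<^sub>a id_arr \<one>) \<cdot> asc C X \<one> \<one>"
    unfolding lun_tensor[OF assms unit_obj, symmetric] by (simp add: arr_comp_assoc)
  finally have "(run C X \<otimes>\<^sub>a id_arr \<one>) \<cdot> asc C X \<one> \<one> = (?t \<otimes>\<^sub>a id_arr \<one>) \<cdot> asc C X \<one> \<one>"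
    by (simp add: triangle lun_unit)
  then have "run C X \<otimes>\<^sub>a id_arr \<one> = ?t \<otimes>\<^sub>a id_arr \<one>"
    by - (rule cancel_right[of "asc C X \<one> \<one>"], simp_all)
  then show ?thesis by - (rule unit_tensor_faithful(2)[symmetric], simp_all)
qed

lemma lun_tensor_inv:
  assumes [simp]: "X \<in> obj C" "Y \<in> obj C"
  shows "lun C X \<otimes>\<^sub>a id_arr Y = lun C (X \<otimes> Y) \<cdot> inv_arr V (asc C \<one> X Y)"
  unfolding lun_tensor[OF assms, symmetric] by (simp add: arr_comp_assoc)

lemma triangle_inv:
  assumes [simp]: "X \<in> obj C" "Y \<in> obj C"
  shows "inv_arr V (asc C X \<one> Y) \<cdot> (inv_arr V (run C X) \<otimes>\<^sub>a id_arr Y) = id_arr X \<otimes>\<^sub>a inv_arr V (lun C Y)"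
proof -
  have "(id_arr X \<otimes>\<^sub>a lun C Y) \<cdot> inv_arr V (asc C X \<one> Y) \<cdot> (inv_arr V (run C X) \<otimes>\<^sub>a id_arr Y)
      = ((run C X \<otimes>\<^sub>a id_arr Y) \<cdot> asc C X \<one> Y) \<cdot> inv_arr V (asc C X \<one> Y) \<cdot> (inv_arr V (run C X) \<otimes>\<^sub>a id_arr Y)"
    by (simp only: triangle assms)
  also have "\<dots> = (id_arr X \<otimes>\<^sub>a lun C Y) \<cdot> (id_arr X \<otimes>\<^sub>a inv_arr V (lun C Y))"
    by (simp add: arr_comp_assoc)
  finally
  show ?thesis by - (rule cancel_left[of "id_arr X \<otimes>\<^sub>a lun C Y"], simp_all)
qed

text \<open>The pentagon solved for the two associators that meet in \<open>ev_mate\<close>.\<close>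

lemma pentagon_inv:
  assumes [simp]: "W \<in> obj C" "X \<in> obj C" "Y \<in> obj C" "Z \<in> obj C"
  shows "inv_arr V (asc C (W \<otimes> X) Y Z) \<cdot> (asc C W X Y \<otimes>\<^sub>a id_arr Z) =
    asc C W X (Y \<otimes> Z) \<cdot> (id_arr W \<otimes>\<^sub>a inv_arr V (asc C X Y Z)) \<cdot> inv_arr V (asc C W (X \<otimes> Y) Z)"
proof -
  have "asc C (W \<otimes> X) Y Z \<cdot> asc C W X (Y \<otimes> Z) \<cdot> (id_arr W \<otimes>\<^sub>a inv_arr V (asc C X Y Z))
      \<cdot> inv_arr V (asc C W (X \<otimes> Y) Z)
    = ((asc C W X Y \<otimes>\<^sub>a id_arr Z) \<cdot> asc C W (X \<otimes> Y) Z \<cdot> (id_arr W \<otimes>\<^sub>a asc C X Y Z))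
      \<cdot> (id_arr W \<otimes>\<^sub>a inv_arr V (asc C X Y Z)) \<cdot> inv_arr V (asc C W (X \<otimes> Y) Z)"
    unfolding pentagon[OF assms, symmetric] arr_comp_assoc ..
  also have "\<dots> = asc C W X Y \<otimes>\<^sub>a id_arr Z"
    by (simp add: arr_comp_assoc)
  finally show ?thesis
    by - (rule cancel_left[of "asc C (W \<otimes> X) Y Z"], simp_all)
qed

section \<open>Closing a loop beside a strand, and endomorphisms of the unit\<close>

lemma left_dualD:
  assumes "left_dual X D e i" "X \<in> obj C"
  shows "D \<in> obj C" "mor e" "src e = D \<otimes> X" "tgt e = \<one>" "mor i" "src i = \<one>" "tgt i = X \<otimes> D"
    "run C X \<cdot> (id_arr X \<otimes>\<^sub>a e) \<cdot> inv_arr V (asc C X D X) \<cdot> (i \<otimes>\<^sub>a id_arr X)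
       \<cdot> inv_arr V (lun C X) = id_arr X"
proof -
  show D: "D \<in> obj C" using assms by (simp add: left_dual_def)
  show "mor e" "src e = D \<otimes> X" "tgt e = \<one>" "mor i" "src i = \<one>" "tgt i = X \<otimes> D"
    using assms D morI[of e "D \<otimes> X" \<one>] morI[of i \<one> "X \<otimes> D"] by (simp_all add: left_dual_def)
qed (use assms in \<open>simp add: left_dual_def\<close>)

text \<open>Rewriting \<open>run C X\<close> as \<open>lun C X\<close> after c_{X,1} provides a
  braiding through which the coevaluation of the zigzag can slide. It becomes c_{X,X \<otimes> D},
  which splits into the scalar c and id \<otimes> c_{X,D}; the evaluation then closes the loop q to
  the right of the strand X.\<close>

lemma braiding_scalar_loop:
  assumes X [simp]: "X \<in> obj C" and dual: "left_dual X D e i"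
    and c: "brd C X X = scale_arr c (id_arr (X \<otimes> X))"
    and q: "e \<cdot> brd C X D \<cdot> i = scale_arr q (id_arr \<one>)"
  shows "scale_arr (c * q) (id_arr X) = id_arr X"
proof -
  note [simp] = left_dualD(1-7)[OF dual X]
  \<comment> \<open>In the hexagon c_{X,X} stands between an associator and its inverse; being
    scalar, it lets them cancel.\<close>
  have hex: "inv_arr V (asc C X D X) \<cdot> brd C X (X \<otimes> D) = scale_arr c (id_arr X \<otimes>\<^sub>a brd C X D)"
    by (subst hexagon1) (simp_all add: c)
  have "run C X = lun C X \<cdot> brd C X \<one>" by (simp add: lun_brd)
  \<comment> \<open>Insert the zigzag identity for X; its inverse of \<open>lun C X\<close> will
    cancel against the \<open>lun C X\<close> already present.\<close>
  also have "\<dots> = (run C X \<cdot> (id_arr X \<otimes>\<^sub>a e) \<cdot> inv_arr V (asc C X D X) \<cdot> (i \<otimes>\<^sub>a id_arr X)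
       \<cdot> inv_arr V (lun C X)) \<cdot> lun C X \<cdot> brd C X \<one>"
    unfolding left_dualD(8)[OF dual X] by simp
  also have "\<dots> = run C X \<cdot> (id_arr X \<otimes>\<^sub>a e) \<cdot> inv_arr V (asc C X D X) \<cdot> (i \<otimes>\<^sub>a id_arr X) \<cdot> brd C X \<one>"
    by (simp add: arr_comp_assoc)
  also have "(i \<otimes>\<^sub>a id_arr X) \<cdot> brd C X \<one> = brd C X (X \<otimes> D) \<cdot> (id_arr X \<otimes>\<^sub>a i)"
    using brd_nat[of "id_arr X" i] by simp
  also have "inv_arr V (asc C X D X) \<cdot> brd C X (X \<otimes> D) \<cdot> (id_arr X \<otimes>\<^sub>a i)
      = scale_arr c ((id_arr X \<otimes>\<^sub>a brd C X D) \<cdot> (id_arr X \<otimes>\<^sub>a i))"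
    unfolding arr_comp_assoc[symmetric] hex by simp
  also have "run C X \<cdot> (id_arr X \<otimes>\<^sub>a e) \<cdot> \<dots> = scale_arr c (run C X \<cdot> (id_arr X \<otimes>\<^sub>a (e \<cdot> brd C X D \<cdot> i)))"
    by simp
  also have "\<dots> = scale_arr (c * q) (id_arr X) \<cdot> run C X"
    unfolding q by simp
  finally have "id_arr X \<cdot> run C X = scale_arr (c * q) (id_arr X) \<cdot> run C X" by simp
  then show ?thesis by - (rule sym, rule cancel_right[of "run C X"], simp_all)
qed

text \<open>Tensoring with J turns f into an endomorphism of J, where Schur applies. Tensoring once
  more and using J \<otimes> J \<cong> 1 returns to the unit, with the same scalar.\<close>

lemma End_unit_scalar:
  assumes J [simp]: "J \<in> obj C" and schur: "\<And>g. g \<in> hom V J J \<Longrightarrow> \<exists>c. g = scale_arr c (id_arr J)"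
    and \<phi>: "\<phi> \<in> iso V (J \<otimes> J) \<one>" and f [simp]: "mor f" "src f = \<one>" "tgt f = \<one>"
  shows "\<exists>c. f = scale_arr c (id_arr \<one>)"
proof -
  note [simp] = conjunct1[OF invertible_arrI[OF \<phi>]] conjunct2[OF invertible_arrI[OF \<phi>]]
  \<comment> \<open>Schur is available on J only, hence the conjugation from J \<otimes> 1 to
    J.\<close>
  obtain s where s: "run C J \<cdot> (id_arr J \<otimes>\<^sub>a f) \<cdot> inv_arr V (run C J) = scale_arr s (id_arr J)"
    using schur[OF mor_hom[of "run C J \<cdot> (id_arr J \<otimes>\<^sub>a f) \<cdot> inv_arr V (run C J)"]] by auto
  have "id_arr J \<otimes>\<^sub>a f
      = inv_arr V (run C J) \<cdot> (run C J \<cdot> (id_arr J \<otimes>\<^sub>a f) \<cdot> inv_arr V (run C J)) \<cdot> run C J"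
    by (simp add: arr_comp_assoc)
  then have Jf: "id_arr J \<otimes>\<^sub>a f = scale_arr s (id_arr (J \<otimes> \<one>))"
    unfolding s by simp
  have "(id_arr (J \<otimes> J) \<otimes>\<^sub>a f) \<cdot> asc C J J \<one> = scale_arr s (id_arr ((J \<otimes> J) \<otimes> \<one>)) \<cdot> asc C J J \<one>"
    using asc_nat[of "id_arr J" "id_arr J" f] by (simp add: Jf)
  then have JJf: "id_arr (J \<otimes> J) \<otimes>\<^sub>a f = scale_arr s (id_arr ((J \<otimes> J) \<otimes> \<one>))"
    by - (rule cancel_right[of "asc C J J \<one>"], simp_all)
  \<comment> \<open>The interchange law lets \<open>\<phi>\<close> replace the factor J \<otimes> J
    by the unit.\<close>
  have "(id_arr \<one> \<otimes>\<^sub>a f) \<cdot> (\<phi> \<otimes>\<^sub>a id_arr \<one>) = (\<phi> \<otimes>\<^sub>a id_arr \<one>) \<cdot> (id_arr (J \<otimes> J) \<otimes>\<^sub>a f)"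
    by simp
  also have "\<dots> = (id_arr \<one> \<otimes>\<^sub>a scale_arr s (id_arr \<one>)) \<cdot> (\<phi> \<otimes>\<^sub>a id_arr \<one>)"
    unfolding JJf by simp
  finally have "id_arr \<one> \<otimes>\<^sub>a f = id_arr \<one> \<otimes>\<^sub>a scale_arr s (id_arr \<one>)"
    by - (rule cancel_right[of "\<phi> \<otimes>\<^sub>a id_arr \<one>"], simp_all)
  then have "f = scale_arr s (id_arr \<one>)"
    by - (rule unit_tensor_faithful(1), simp_all)
  then show ?thesis ..
qed

end

section \<open>Duality pairings and the quantum dimension\<close>

context ribbon_vertex_tensor_category
begin

lemma dual_simps [simp]:
  assumes "X \<in> obj C"
  shows "X\<^sup>\<or> \<in> obj C" "mor (ev R X)" "src (ev R X) = X\<^sup>\<or> \<otimes> X" "tgt (ev R X) = \<one>"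
    "mor (coev R X)" "src (coev R X) = \<one>" "tgt (coev R X) = X \<otimes> X\<^sup>\<or>"
  using left_dualD(1-7)[OF has_left_dual[OF assms] assms] by simp_all

lemma mate_simps [simp]:
  assumes "mor p" "src p = D \<otimes> Z" "tgt p = \<one>" "D \<in> obj C" "Z \<in> obj C"
  shows "mor (mate D Z p)" "src (mate D Z p) = D" "tgt (mate D Z p) = Z\<^sup>\<or>"
  using assms by (simp_all add: mate_def)

text \<open>One half of the bijection between pairings of D with Z and arrows from D to the dual of
  Z. In string diagrams it is a single zigzag on Z; the length is the bookkeeping of associators and
  units.\<close>

lemma ev_mate:
  assumes [simp]: "mor p" "src p = D \<otimes> Z" "tgt p = \<one>" "D \<in> obj C" "Z \<in> obj C"
  shows "ev R Z \<cdot> (mate D Z p \<otimes>\<^sub>a id_arr Z) = p"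
proof -
  let ?W = "Z\<^sup>\<or>" and ?e = "ev R Z" and ?i = "coev R Z"
  \<comment> \<open>The part of the mate that precedes the pairing \<open>p\<close>: it creates Z
    and its dual to the right of D.\<close>
  let ?u = "asc C D Z ?W \<cdot> (id_arr D \<otimes>\<^sub>a ?i) \<cdot> inv_arr V (run C D)"
  have "inv_arr V (asc C (D \<otimes> Z) ?W Z) \<cdot> (?u \<otimes>\<^sub>a id_arr Z)
      = (inv_arr V (asc C (D \<otimes> Z) ?W Z) \<cdot> (asc C D Z ?W \<otimes>\<^sub>a id_arr Z))
        \<cdot> ((id_arr D \<otimes>\<^sub>a ?i) \<otimes>\<^sub>a id_arr Z) \<cdot> (inv_arr V (run C D) \<otimes>\<^sub>a id_arr Z)"
    by (simp add: arr_comp_assoc)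
  also have "\<dots> = asc C D Z (?W \<otimes> Z) \<cdot> (id_arr D \<otimes>\<^sub>a inv_arr V (asc C Z ?W Z)) \<cdot>
        (inv_arr V (asc C D (Z \<otimes> ?W) Z) \<cdot> ((id_arr D \<otimes>\<^sub>a ?i) \<otimes>\<^sub>a id_arr Z))
        \<cdot> (inv_arr V (run C D) \<otimes>\<^sub>a id_arr Z)"
    by (subst pentagon_inv) (simp_all add: arr_comp_assoc)
  also have "\<dots> = asc C D Z (?W \<otimes> Z) \<cdot> (id_arr D \<otimes>\<^sub>a inv_arr V (asc C Z ?W Z)) \<cdot>
        (id_arr D \<otimes>\<^sub>a (?i \<otimes>\<^sub>a id_arr Z)) \<cdot>
        (inv_arr V (asc C D \<one> Z) \<cdot> (inv_arr V (run C D) \<otimes>\<^sub>a id_arr Z))"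
    using asc_inv_nat[of "id_arr D" ?i "id_arr Z"] by (simp add: arr_comp_assoc)
  also have "\<dots> = asc C D Z (?W \<otimes> Z) \<cdot>
        (id_arr D \<otimes>\<^sub>a (inv_arr V (asc C Z ?W Z) \<cdot> (?i \<otimes>\<^sub>a id_arr Z) \<cdot> inv_arr V (lun C Z)))"
    by (subst triangle_inv) simp_all
  finally have u: "inv_arr V (asc C (D \<otimes> Z) ?W Z) \<cdot> (?u \<otimes>\<^sub>a id_arr Z) = \<dots>" .
  have "run C (D \<otimes> Z) \<cdot> (id_arr (D \<otimes> Z) \<otimes>\<^sub>a ?e) \<cdot> inv_arr V (asc C (D \<otimes> Z) ?W Z) \<cdot> (?u \<otimes>\<^sub>a id_arr Z)
      = run C (D \<otimes> Z) \<cdot> ((id_arr (D \<otimes> Z) \<otimes>\<^sub>a ?e) \<cdot> asc C D Z (?W \<otimes> Z)) \<cdot>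
        (id_arr D \<otimes>\<^sub>a (inv_arr V (asc C Z ?W Z) \<cdot> (?i \<otimes>\<^sub>a id_arr Z) \<cdot> inv_arr V (lun C Z)))"
    unfolding u by (simp add: arr_comp_assoc)
  also have "(id_arr (D \<otimes> Z) \<otimes>\<^sub>a ?e) \<cdot> asc C D Z (?W \<otimes> Z) = asc C D Z \<one> \<cdot> (id_arr D \<otimes>\<^sub>a (id_arr Z \<otimes>\<^sub>a ?e))"
    using asc_nat[of "id_arr D" "id_arr Z" ?e] by simp
  also have "run C (D \<otimes> Z) \<cdot> (asc C D Z \<one> \<cdot> (id_arr D \<otimes>\<^sub>a (id_arr Z \<otimes>\<^sub>a ?e))) \<cdot>
        (id_arr D \<otimes>\<^sub>a (inv_arr V (asc C Z ?W Z) \<cdot> (?i \<otimes>\<^sub>a id_arr Z) \<cdot> inv_arr V (lun C Z)))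
      = (run C (D \<otimes> Z) \<cdot> asc C D Z \<one>) \<cdot> (id_arr D \<otimes>\<^sub>a ((id_arr Z \<otimes>\<^sub>a ?e) \<cdot>
          inv_arr V (asc C Z ?W Z) \<cdot> (?i \<otimes>\<^sub>a id_arr Z) \<cdot> inv_arr V (lun C Z)))"
    by (simp add: arr_comp_assoc)
  also have "\<dots> = id_arr D \<otimes>\<^sub>a (run C Z \<cdot> (id_arr Z \<otimes>\<^sub>a ?e) \<cdot>
          inv_arr V (asc C Z ?W Z) \<cdot> (?i \<otimes>\<^sub>a id_arr Z) \<cdot> inv_arr V (lun C Z))"
    by (subst run_tensor) simp_all
  also have "\<dots> = id_arr (D \<otimes> Z)"
    by (subst left_dualD(8)[OF has_left_dual]) simp_all
  finally have zigzag: "run C (D \<otimes> Z) \<cdot> (id_arr (D \<otimes> Z) \<otimes>\<^sub>a ?e) \<cdot> inv_arr V (asc C (D \<otimes> Z) ?W Z)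
      \<cdot> (?u \<otimes>\<^sub>a id_arr Z) = id_arr (D \<otimes> Z)" .
  \<comment> \<open>It remains to pull \<open>p\<close> to the front, by naturality of both unit
    isomorphisms and \<open>lun_unit\<close>, so that only the zigzag stands behind it.\<close>
  have "?e \<cdot> (mate D Z p \<otimes>\<^sub>a id_arr Z)
      = ?e \<cdot> (lun C ?W \<otimes>\<^sub>a id_arr Z) \<cdot> ((p \<otimes>\<^sub>a id_arr ?W) \<otimes>\<^sub>a id_arr Z) \<cdot> (?u \<otimes>\<^sub>a id_arr Z)"
    by (simp add: mate_def arr_comp_assoc)
  also have "\<dots> = (?e \<cdot> lun C (?W \<otimes> Z)) \<cdot>
      (inv_arr V (asc C \<one> ?W Z) \<cdot> ((p \<otimes>\<^sub>a id_arr ?W) \<otimes>\<^sub>a id_arr Z)) \<cdot> (?u \<otimes>\<^sub>a id_arr Z)"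
    by (subst lun_tensor_inv) (simp_all only: arr_comp_assoc assms dual_simps)
  also have "?e \<cdot> lun C (?W \<otimes> Z) = run C \<one> \<cdot> (id_arr \<one> \<otimes>\<^sub>a ?e)"
    using lun_nat[of ?e] by (simp add: lun_unit)
  also have "inv_arr V (asc C \<one> ?W Z) \<cdot> ((p \<otimes>\<^sub>a id_arr ?W) \<otimes>\<^sub>a id_arr Z)
      = (p \<otimes>\<^sub>a id_arr (?W \<otimes> Z)) \<cdot> inv_arr V (asc C (D \<otimes> Z) ?W Z)"
    using asc_inv_nat[of p "id_arr ?W" "id_arr Z"] by simp
  also have "(run C \<one> \<cdot> (id_arr \<one> \<otimes>\<^sub>a ?e)) \<cdot> ((p \<otimes>\<^sub>a id_arr (?W \<otimes> Z)) \<cdot>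
        inv_arr V (asc C (D \<otimes> Z) ?W Z)) \<cdot> (?u \<otimes>\<^sub>a id_arr Z)
      = (run C \<one> \<cdot> (p \<otimes>\<^sub>a id_arr \<one>)) \<cdot> (id_arr (D \<otimes> Z) \<otimes>\<^sub>a ?e) \<cdot>
        inv_arr V (asc C (D \<otimes> Z) ?W Z) \<cdot> (?u \<otimes>\<^sub>a id_arr Z)"
    by (simp add: arr_comp_assoc)
  also have "run C \<one> \<cdot> (p \<otimes>\<^sub>a id_arr \<one>) = p \<cdot> run C (D \<otimes> Z)"
    using run_nat[of p] by simp
  also have "(p \<cdot> run C (D \<otimes> Z)) \<cdot> (id_arr (D \<otimes> Z) \<otimes>\<^sub>a ?e) \<cdot>
        inv_arr V (asc C (D \<otimes> Z) ?W Z) \<cdot> (?u \<otimes>\<^sub>a id_arr Z) = p"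
    unfolding arr_comp_assoc[of p] zigzag by simp
  finally show ?thesis .
qed

text \<open>The Drinfeld isomorphism is the mate of the pairing given by ev after the braiding of X
  with its dual, so evaluating against it returns that pairing by \<open>ev_mate\<close>.\<close>

lemma trace1_id:
  assumes [simp]: "X \<in> obj C" and \<theta>: "twist V X = scale_arr t (id_arr X)"
  shows "trace1 (id_arr X) = scale_arr t (ev R X \<cdot> brd C X (X\<^sup>\<or>) \<cdot> coev R X)"
proof -
  have "piv R X \<cdot> id_arr X = scale_arr t (drinfeld X)"
    by (simp add: piv_twist \<theta> drinfeld_def)
  then have "trace1 (id_arr X) = scale_arr t ((ev R (X\<^sup>\<or>) \<cdot> (drinfeld X \<otimes>\<^sub>a id_arr (X\<^sup>\<or>))) \<cdot> coev R X)"
    by (simp add: trace1_def drinfeld_def arr_comp_assoc)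
  then show ?thesis
    by (simp add: drinfeld_def ev_mate arr_comp_assoc)
qed

lemma braiding_scalar_qdim:
  assumes [simp]: "J \<in> obj C" and \<phi>: "\<phi> \<in> iso V (J \<otimes> J) \<one>"
    and schur: "\<And>g. g \<in> hom V J J \<Longrightarrow> \<exists>c. g = scale_arr c (id_arr J)"
    and \<theta>: "twist V J = scale_arr t (id_arr J)"
    and x: "x \<in> car J" "x \<noteq> 0" and vac: "vac V \<noteq> 0" and JJ: "y \<in> car (J \<otimes> J)" "y \<noteq> 0"
  shows "braiding_scalar J * qdim J = t"
proof -
  note [simp] = conjunct1[OF invertible_arrI[OF \<phi>]] conjunct2[OF invertible_arrI[OF \<phi>]]
  note unit = End_unit_scalar[OF assms(1) schur \<phi>]
  \<comment> \<open>Conjugated by \<open>\<phi>\<close>, the self-braiding is an endomorphism of the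
    unit.\<close>
  obtain c where c: "\<phi> \<cdot> brd C J J \<cdot> inv_arr V \<phi> = scale_arr c (id_arr \<one>)"
    using unit[of "\<phi> \<cdot> brd C J J \<cdot> inv_arr V \<phi>"] by auto
  obtain q where q: "ev R J \<cdot> brd C J (J\<^sup>\<or>) \<cdot> coev R J = scale_arr q (id_arr \<one>)"
    using unit[of "ev R J \<cdot> brd C J (J\<^sup>\<or>) \<cdot> coev R J"] by auto
  have "brd C J J = inv_arr V \<phi> \<cdot> (\<phi> \<cdot> brd C J J \<cdot> inv_arr V \<phi>) \<cdot> \<phi>"
    by (simp add: arr_comp_assoc)
  then have brd: "brd C J J = scale_arr c (id_arr (J \<otimes> J))"
    unfolding c by simp
  have "scalar_of (scale_arr (c * q) (id_arr J)) = scalar_of (scale_arr 1 (id_arr J))"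
    using braiding_scalar_loop[OF assms(1) has_left_dual[OF assms(1)] brd q] by simp
  then have "c * q = 1"
    using scalar_of_scale_id[OF x] by metis
  moreover have "braiding_scalar J = c"
    unfolding braiding_scalar_def brd using JJ by (rule scalar_of_scale_id)
  moreover have "qdim J = t * q"
    unfolding qdim_def trace1_id[OF assms(1) \<theta>] q scale_arr_scale_arr
    by (rule scalar_of_scale_id[of "vac V"]) (use vac vac_in in \<open>auto simp: voa_wt_def\<close>)
  ultimately show ?thesis by simp
qed

end

section \<open>Generalized eigenvectors\<close>

lemma linear_on_sum:
  assumes "linear_on A B f" "cvs.subspace A" "finite F" "\<And>i. i \<in> F \<Longrightarrow> g i \<in> A"
  shows "f (sum g F) = (\<Sum>i\<in>F. f (g i))"
  using assms(3,4)
proof (induction F rule: finite_induct)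
  case empty
  have "f (0 *\<^sub>C 0) = 0 *\<^sub>C f 0"
    using assms(1,2) unfolding linear_on_def cvs.subspace_def by blast
  then show ?case by simp
next
  case (insert i F)
  then have "g i \<in> A" "sum g F \<in> A" using assms(2) by (auto intro: cvs.subspace_sum)
  then show ?case using insert assms(1) by (simp add: linear_on_def)
qed

lemma linear_on_funpow: "linear_on A A T \<Longrightarrow> linear_on A A (T ^^ k)"
  by (induction k) (simp_all add: linear_on_def)

lemma linear_on_shift:
  assumes "linear_on A A T" "cvs.subspace A"
  shows "linear_on A A (\<lambda>x. T x - c *\<^sub>C x)"
  using assms
  by (simp add: linear_on_def cvs.subspace_diff cvs.subspace_scale algebra_simps
      cvs.scale_right_diff_distrib scaleC_add_right cvs.scale_left_commute)

locale linear_endomorphism =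
  fixes A :: "'a::complex_vector_space set" and T :: "'a \<Rightarrow> 'a"
  assumes subspace: "cvs.subspace A" and linear: "linear_on A A T"
begin

definition shift :: "complex \<Rightarrow> 'a \<Rightarrow> 'a" where
  "shift c x = T x - c *\<^sub>C x"

lemma shift_linear: "linear_on A A (shift c ^^ k)"
  using linear_on_funpow[OF linear_on_shift[OF linear subspace, of c]] unfolding shift_def[abs_def] .

lemma shift_simps:
  shows "x \<in> A \<Longrightarrow> (shift c ^^ k) x \<in> A"
    "x \<in> A \<Longrightarrow> y \<in> A \<Longrightarrow> (shift c ^^ k) (x + y) = (shift c ^^ k) x + (shift c ^^ k) y"
    "x \<in> A \<Longrightarrow> (shift c ^^ k) (a *\<^sub>C x) = a *\<^sub>C (shift c ^^ k) x"
    "(shift c ^^ k) 0 = 0"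
proof -
  show *: "x \<in> A \<Longrightarrow> (shift c ^^ k) x \<in> A"
    "x \<in> A \<Longrightarrow> y \<in> A \<Longrightarrow> (shift c ^^ k) (x + y) = (shift c ^^ k) x + (shift c ^^ k) y"
    "x \<in> A \<Longrightarrow> (shift c ^^ k) (a *\<^sub>C x) = a *\<^sub>C (shift c ^^ k) x" for x y a
    using shift_linear[where c = c and k = k] by (auto simp: linear_on_def)
  show "(shift c ^^ k) 0 = 0"
    using *(3)[where x = 0 and a = 0] subspace by (simp add: cvs.subspace_0)
qed

lemma T_simps:
  assumes "x \<in> A"
  shows "T x \<in> A" "y \<in> A \<Longrightarrow> T (x - y) = T x - T y" "T (c *\<^sub>C x) = c *\<^sub>C T x"
proof -
  show "T x \<in> A" "T (c *\<^sub>C x) = c *\<^sub>C T x" using linear assms by (simp_all add: linear_on_def)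
  assume y: "y \<in> A"
  have "T (x + (-1) *\<^sub>C y) = T x + (-1) *\<^sub>C T y"
    using linear assms y subspace by (simp only: linear_on_def cvs.subspace_scale)
  then show "T (x - y) = T x - T y" by (simp add: cvs.scale_minus_left)
qed

lemma shift_commute:
  assumes "x \<in> A"
  shows "(shift c ^^ j) ((shift d ^^ k) x) = (shift d ^^ k) ((shift c ^^ j) x)"
proof -
  have 1: "shift c (shift d y) = shift d (shift c y)" if "y \<in> A" for y
    using T_simps[OF that] T_simps(2)[OF T_simps(1)[OF that] cvs.subspace_scale[OF subspace that]]
    by (simp add: shift_def cvs.scale_right_diff_distrib algebra_simps)
  have 2: "shift c ((shift d ^^ k) y) = (shift d ^^ k) (shift c y)" if "y \<in> A" for y
    using that by (induction k) (simp_all add: 1 shift_simps(1))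
  show ?thesis
    using assms by (induction j) (simp_all add: 2 shift_simps(1))
qed

text \<open>The last iterate y under T - m is an honest eigenvector, possibly zero, on which T - n
  acts as the nonzero scalar m - n. Nilpotency of T - n on it forces y = 0, which lowers j.\<close>

lemma generalized_eigenvector_unique:
  assumes "n \<noteq> m" "x \<in> A" "(shift n ^^ k) x = 0" "(shift m ^^ j) x = 0"
  shows "x = 0"
  using assms(4)
proof (induction j)
  case (Suc j)
  define y where "y = (shift m ^^ j) x"
  have "shift m y = 0" using Suc.prems by (simp add: y_def)
  then have y: "y \<in> A" "T y = m *\<^sub>C y"
    using assms(2) by (simp_all add: y_def shift_simps(1)) (simp add: shift_def)
  have "(shift n ^^ i) y = (m - n) ^ i *\<^sub>C y" for i
  proof (induction i)
    case (Suc i)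
    have "(shift n ^^ Suc i) y = shift n ((m - n) ^ i *\<^sub>C y)" using Suc by simp
    also have "\<dots> = (m - n) ^ i *\<^sub>C shift n y" using shift_simps(3)[where x = y and c = n and k = 1] y by simp
    also have "shift n y = (m - n) *\<^sub>C y" using y(2) by (simp add: shift_def cvs.scale_left_diff_distrib)
    finally show ?case by (simp add: mult.commute)
  qed simp
  moreover have "(shift n ^^ k) y = 0"
    unfolding y_def using assms(2,3) by (simp add: shift_commute shift_simps)
  ultimately have "y = 0" using assms(1) by simp
  then show ?case using Suc.IH y_def by simp
qed simp

text \<open>Apply a power of T - m that kills \<open>f m\<close>. The other images remain
  generalized eigenvectors and vanish by induction, so each remaining \<open>f i\<close> belongs to
  both i and m and is zero.\<close>

lemma generalized_eigenvectors_independent: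
  assumes "finite F" "\<And>n. n \<in> F \<Longrightarrow> f n \<in> A \<and> (\<exists>k. (shift n ^^ k) (f n) = 0)"
    and "sum f F = 0" and "n \<in> F"
  shows "f n = 0"
  using assms
proof (induction F arbitrary: f n rule: finite_induct)
  case (insert m F)
  obtain k where k: "(shift m ^^ k) (f m) = 0" using insert.prems by auto
  let ?S = "shift m ^^ k"
  have fA: "f i \<in> A" if "i \<in> insert m F" for i using insert.prems that by auto
  have zero: "f i = 0" if "i \<in> F" for i
  proof -
    have "?S (sum f (insert m F)) = (\<Sum>i\<in>insert m F. ?S (f i))"
      using insert.hyps fA by (intro linear_on_sum[OF shift_linear subspace]) auto
    then have "(\<Sum>i\<in>F. ?S (f i)) = 0"
      using insert.hyps insert.prems k by (simp add: shift_simps)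
    then have "?S (f i) = 0"
    proof (rule insert.IH[rotated])
      show "i \<in> F" by fact
      fix j assume j: "j \<in> F"
      then obtain l where "(shift j ^^ l) (f j) = 0" using insert.prems by auto
      then have "(shift j ^^ l) (?S (f j)) = 0"
        using fA[of j] j by (simp add: shift_commute[where c = j and j = l and d = m and k = k] shift_simps)
      then show "?S (f j) \<in> A \<and> (\<exists>l. (shift j ^^ l) (?S (f j)) = 0)"
        using fA[of j] j by (auto simp: shift_simps)
    qed
    moreover obtain l where "(shift i ^^ l) (f i) = 0" using insert.prems \<open>i \<in> F\<close> by auto
    ultimately show ?thesis
      using generalized_eigenvector_unique[of i m "f i" l k] fA[of i] \<open>i \<in> F\<close> insert.hyps by auto
  qed
  then have "f m = 0" using insert.prems insert.hyps by simp
  then show ?case using zero insert.prems by auto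
qed simp

section \<open>Polynomials in an endomorphism and existence of eigenvectors\<close>

definition poly_app :: "complex poly \<Rightarrow> 'a \<Rightarrow> 'a" where
  "poly_app p x = (\<Sum>i\<le>degree p. coeff p i *\<^sub>C (T ^^ i) x)"

lemma poly_app_bound:
  assumes "degree p \<le> n"
  shows "poly_app p x = (\<Sum>i\<le>n. coeff p i *\<^sub>C (T ^^ i) x)"
  unfolding poly_app_def using assms
  by (intro sum.mono_neutral_left) (auto simp: coeff_eq_0)

lemma T_pow: "x \<in> A \<Longrightarrow> (T ^^ i) x \<in> A"
  using linear_on_funpow[OF linear] by (simp add: linear_on_def)

lemma poly_app_in: "x \<in> A \<Longrightarrow> poly_app p x \<in> A"
  unfolding poly_app_def using subspace by (auto intro!: cvs.subspace_sum cvs.subspace_scale T_pow)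

lemma poly_app_linear_factor:
  assumes "x \<in> A"
  shows "poly_app ([:-c, 1:] * q) x = T (poly_app q x) - c *\<^sub>C poly_app q x"
proof -
  \<comment> \<open>Expand (X - c) q as X q - c q, with sums up to \<open>Suc (degree q)\<close>;
    the coefficient of q at that last index is 0.\<close>
  have "poly_app ([:-c, 1:] * q) x
      = (\<Sum>i\<le>Suc (degree q). coeff (pCons 0 q - smult c q) i *\<^sub>C (T ^^ i) x)"
    by (subst poly_app_bound[of _ "Suc (degree q)"])
      (auto intro!: degree_diff_le degree_pCons_le degree_smult_le[THEN order_trans])
  also have "\<dots> = (\<Sum>i\<le>Suc (degree q). coeff (pCons 0 q) i *\<^sub>C (T ^^ i) x)
      - c *\<^sub>C (\<Sum>i\<le>Suc (degree q). coeff q i *\<^sub>C (T ^^ i) x)"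
    by (simp only: coeff_diff coeff_smult cvs.scale_left_diff_distrib sum_subtractf
        cvs.scale_sum_right scaleC_scaleC)
  also have "(\<Sum>i\<le>Suc (degree q). coeff (pCons 0 q) i *\<^sub>C (T ^^ i) x)
      = (\<Sum>i\<le>degree q. coeff q i *\<^sub>C T ((T ^^ i) x))"
    by (subst sum.atMost_Suc_shift) simp
  also have "\<dots> = (\<Sum>i\<le>degree q. T (coeff q i *\<^sub>C (T ^^ i) x))"
    using linear T_pow[OF assms] by (simp add: linear_on_def)
  also have "\<dots> = T (poly_app q x)"
    unfolding poly_app_def using T_pow[OF assms] subspace
    by (intro linear_on_sum[OF linear subspace, symmetric]) (auto intro: cvs.subspace_scale)
  finally show ?thesis by (simp only: poly_app_bound[of q "Suc (degree q)", OF le_SucI[OF order_refl]])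
qed

text \<open>Split off a root c, so that p = (X - c) q. Either q(T) x = 0 with q of smaller degree,
  or q(T) x is itself an eigenvector for c.\<close>

lemma eigenvector_of_annihilator:
  assumes "x \<in> A" "x \<noteq> 0" "p \<noteq> 0" "poly_app p x = 0"
  shows "\<exists>c. \<exists>y\<in>A. y \<noteq> 0 \<and> T y = c *\<^sub>C y"
  using assms(3,4)
proof (induction "degree p" arbitrary: p rule: less_induct)
  case less
  have "degree p \<noteq> 0"
  proof
    assume "degree p = 0"
    then have "poly_app p x = coeff p 0 *\<^sub>C x" "coeff p 0 \<noteq> 0"
      using less.prems leading_coeff_0_iff[of p] by (auto simp: poly_app_def)
    then show False using less.prems assms(2) by simp
  qed
  then obtain c where "poly p c = 0"
    using fundamental_theorem_of_algebra[of p] by (auto simp: constant_degree)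
  then obtain q where q: "p = [:-c, 1:] * q" by (metis poly_eq_0_iff_dvd dvdE)
  have "q \<noteq> 0" using q less.prems by auto
  then have deg: "degree q < degree p" unfolding q by (subst degree_mult_eq) auto
  show ?case
  proof (cases "poly_app q x = 0")
    case True
    then show ?thesis using less.hyps[OF deg \<open>q \<noteq> 0\<close>] by blast
  next
    case False
    have "T (poly_app q x) - c *\<^sub>C poly_app q x = 0"
      using less.prems poly_app_linear_factor[OF assms(1)] q by metis
    then show ?thesis using False poly_app_in[OF assms(1), of q] by auto
  qed
qed

text \<open>Only the orbit of x has to lie in a finite-dimensional space; A may be
  infinite-dimensional, as a module is. The first card B + 1 iterates then satisfy a linear
  relation.\<close>

lemma eigenvector_exists:
  assumes x: "x \<in> A" "x \<noteq> 0" and B: "finite B" "\<And>i. (T ^^ i) x \<in> cvs.span B"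
  shows "\<exists>c. \<exists>y\<in>A. y \<noteq> 0 \<and> T y = c *\<^sub>C y"
proof -
  let ?g = "\<lambda>i. (T ^^ i) x" and ?n = "card B"
  have "\<exists>p. p \<noteq> 0 \<and> poly_app p x = 0"
  \<comment> \<open>\<open>cvs.dependent\<close> speaks of sets, so a repeated iterate is treated
    separately; it gives the polynomial X^i - X^j.\<close>
  proof (cases "inj_on ?g {..?n}")
    case True
    have "cvs.dependent (?g ` {..?n})"
    proof (rule ccontr)
      assume "\<not> cvs.dependent (?g ` {..?n})"
      then have "card (?g ` {..?n}) \<le> card B"
        using cvs.independent_span_bound[OF B(1), of "?g ` {..?n}"] B(2) by auto
      then show False by (simp add: card_image[OF True])
    qed
    then obtain u i where u: "(\<Sum>v\<in>?g ` {..?n}. u v *\<^sub>C v) = 0" "i \<le> ?n" "u (?g i) \<noteq> 0"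
      by (auto simp: cvs.dependent_finite)
    define p where "p = (\<Sum>i\<le>?n. monom (u (?g i)) i)"
    have cp: "coeff p j = (if j \<le> ?n then u (?g j) else 0)" for j
      by (simp add: p_def coeff_sum)
    have "degree p \<le> ?n" by (rule degree_le) (simp add: cp)
    then have "poly_app p x = 0"
      using u(1) by (simp add: poly_app_bound cp sum.reindex[OF True])
    moreover have "p \<noteq> 0" using u cp[of i] by auto
    ultimately show ?thesis by blast
  next
    case False
    then obtain i j where ij: "?g i = ?g j" "i \<noteq> j" by (auto simp: inj_on_def)
    let ?p = "monom 1 i - monom 1 j :: complex poly"
    have "degree ?p \<le> max i j" by (intro degree_diff_le) (auto intro: degree_monom_le[THEN order_trans])
    then have "poly_app ?p x = ?g i - ?g j"
      by (subst poly_app_bound)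
        (auto simp: cvs.scale_left_diff_distrib sum_subtractf if_distrib[of "\<lambda>c. c *\<^sub>C _"] cong: if_cong)
    moreover have "?p \<noteq> 0" using ij by (metis coeff_monom eq_iff_diff_eq_0 zero_neq_one)
    ultimately show ?thesis using ij by (metis right_minus_eq)
  qed
  then show ?thesis using eigenvector_of_annihilator[OF x] by blast
qed

end

section \<open>Irreducible modules\<close>

locale irreducible_voa_module = vertex_operator_algebra V
  for V :: "'a::complex_vector_space voa" +
  fixes M :: "'a vmod"
  assumes module: "generalized_module V M" and restricted: "grading_restricted V M"
    and irreducible: "irreducible_module V M"
begin

abbreviation L0 :: "'a \<Rightarrow> 'a" where
  "L0 \<equiv> vir V M 0"

lemma conf_car: "conf V \<in> car (adj V)"
  using conf_in by (simp add: voa_wt_def)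

lemma act_linear: "v \<in> car (adj V) \<Longrightarrow> linear_on (car M) (car M) (act M v n)"
  "w \<in> car M \<Longrightarrow> linear_on (car (adj V)) (car M) (\<lambda>v. act M v n w)"
  using module_car[OF module] by (auto simp: linear_on_def)

sublocale L0: linear_endomorphism "car M" L0
  using module act_linear(1)[OF conf_car, of 1]
  by unfold_locales (simp_all add: generalized_module_def vir_def)

lemma gwt_iff: "w \<in> gwt V M n \<longleftrightarrow> w \<in> car M \<and> (\<exists>k. (L0.shift n ^^ k) w = 0)"
  by (simp add: gwt_def L0.shift_def[abs_def])

text \<open>True eigenspaces, in contrast to \<open>gwt\<close>; \<open>L0_decomposition\<close>
  shows that they suffice on an irreducible module.\<close>

definition L0_space :: "complex \<Rightarrow> 'a set" where
  "L0_space n = {w \<in> car M. L0 w = n *\<^sub>C w}"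

lemma L0_space_subspace: "cvs.subspace (L0_space n)"
  using module_car[OF module] L0.linear L0.shift_simps(4)[where c = n and k = 1]
  by (auto simp: cvs.subspace_def L0_space_def linear_on_def L0.shift_def scaleC_add_right
      cvs.scale_left_commute)

lemma L0_space_car: "w \<in> L0_space n \<Longrightarrow> w \<in> car M"
  by (simp add: L0_space_def)

lemma L0_space_shift: "w \<in> L0_space n \<Longrightarrow> (L0.shift n ^^ Suc k) w = 0"
  unfolding funpow_Suc_right comp_def using L0.shift_simps(4) by (simp add: L0_space_def L0.shift_def)

lemma L0_space_gwt: "L0_space n \<subseteq> gwt V M n"
proof
  fix w assume w: "w \<in> L0_space n"
  then show "w \<in> gwt V M n"
    unfolding gwt_iff using L0_space_shift[OF w, of 0] by (blast dest: L0_space_car)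
qed

lemma gwt_diff: "x \<in> gwt V M n \<Longrightarrow> y \<in> gwt V M n \<Longrightarrow> x - y \<in> gwt V M n"
proof -
  assume "x \<in> gwt V M n" "y \<in> gwt V M n"
  then obtain k j where k: "(L0.shift n ^^ k) x = 0" and j: "(L0.shift n ^^ j) y = 0"
    and xy: "x \<in> car M" "y \<in> car M" by (auto simp: gwt_iff)
  have "(L0.shift n ^^ (k + j)) x = (L0.shift n ^^ (j + k)) x" by (simp add: add.commute)
  also have "\<dots> = 0" by (simp add: funpow_add k L0.shift_simps(4))
  finally have x0: "(L0.shift n ^^ (k + j)) x = 0" .
  have y0: "(L0.shift n ^^ (k + j)) y = 0" by (simp add: funpow_add j L0.shift_simps(4))
  have "(L0.shift n ^^ (k + j)) (x + (-1) *\<^sub>C y) = 0 + (-1) *\<^sub>C 0"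
    using xy module_car(3)[OF module] by (simp only: L0.shift_simps(2,3) x0 y0)
  then show ?thesis
    using xy cvs.subspace_diff[OF L0.subspace] by (auto simp: gwt_iff)
qed

text \<open>Independence of generalized eigenvectors makes the description defining
  \<open>wt_comp\<close> unique, so any decomposition found by hand is the one it denotes.\<close>

lemma wt_comp_eqI:
  assumes "finite {n. f n \<noteq> 0}" "\<And>n. f n \<in> gwt V M n" "w = Sum_any f"
  shows "wt_comp V M w = f"
  unfolding wt_comp_def
proof (rule the_equality)
  fix g assume g: "finite {n. g n \<noteq> 0} \<and> (\<forall>n. g n \<in> gwt V M n) \<and> w = Sum_any g"
  let ?F = "{n. f n \<noteq> 0} \<union> {n. g n \<noteq> 0}"
  have F: "finite ?F" using assms g by auto
  have "Sum_any f = sum f ?F" "Sum_any g = sum g ?F"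
    using F by (auto intro!: Sum_any.expand_superset)
  then have sum0: "(\<Sum>n\<in>?F. g n - f n) = 0" using assms g by (simp add: sum_subtractf)
  have d: "g n - f n \<in> gwt V M n" for n using gwt_diff g assms(2) by blast
  have eq: "g n - f n = 0" if "n \<in> ?F" for n
    by (rule L0.generalized_eigenvectors_independent[OF F _ sum0 that])
      (use d in \<open>simp add: gwt_iff\<close>)
  show "g = f"
  proof
    show "g n = f n" for n using eq[of n] by (cases "n \<in> ?F") auto
  qed
qed (use assms in auto)

section \<open>Weights of an irreducible module\<close>

lemma L0_eigenvalue_iff: "L0_eigenvalue V M n \<longleftrightarrow> (\<exists>w\<in>L0_space n. w \<noteq> 0)"
  by (auto simp: L0_eigenvalue_def L0_space_def)

text \<open>Take a nonzero generalized weight component and its last nonzero iterate under L(0) -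
  n.\<close>

lemma L0_eigenvalue_exists: "\<exists>n. L0_eigenvalue V M n"
proof -
  obtain w where w: "w \<in> car M" "w \<noteq> 0"
    using irreducible module_car(1)[OF module] by (auto simp: irreducible_module_def)
  obtain f where f: "\<And>n. f n \<in> gwt V M n" "w = Sum_any f"
    using module w unfolding generalized_module_def by metis
  have "f \<noteq> (\<lambda>_. 0)" using f(2) w(2) by auto
  then obtain n where "f n \<noteq> 0" by auto
  moreover obtain k where "(L0.shift n ^^ k) (f n) = 0" "f n \<in> car M" using f(1) by (auto simp: gwt_iff)
  ultimately have "\<exists>x\<in>car M. x \<noteq> 0 \<and> L0.shift n x = 0"
  proof (induction k)
    case (Suc k)
    then show ?case using L0.shift_simps(1)[of "f n" k n] by (cases "(L0.shift n ^^ k) (f n) = 0") auto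
  qed simp
  then show ?thesis by (auto simp: L0_eigenvalue_iff L0_space_def L0.shift_def)
qed

text \<open>The commutator [L(0), v_m] = (L(-1)v)_{m+1} + (L(0)v)_m, followed by the
  L(-1)-derivative property, which turns the first term into -(m+1) v_m.\<close>

lemma L0_act:
  assumes v: "v \<in> voa_wt V k" and w: "w \<in> L0_space n"
  shows "act M v m w \<in> L0_space (n + of_int (k - m - 1))"
proof -
  have v': "v \<in> car (adj V)" "act (adj V) (conf V) 1 v = of_int k *\<^sub>C v"
    using v by (simp_all add: voa_wt_def vir_def)
  have w': "w \<in> car M" "act M (conf V) 1 w = n *\<^sub>C w"
    using w by (simp_all add: L0_space_def vir_def)
  \<comment> \<open>The Jacobi identity for the conformal vector and v with exponents 0 and 1: the
    left side keeps only i = 0, the right side only i = 0 and i = 1.\<close>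
  have "Sum_any (\<lambda>i::nat. ((-1) ^ i * (of_int 0 gchoose i)) *\<^sub>C
            (act M (conf V) (1 + 0 - int i) (act M v (m + int i) w)
             - ((-1) powi 0) *\<^sub>C act M v (m + 0 - int i) (act M (conf V) (1 + int i) w)))
        = Sum_any (\<lambda>i::nat. (of_int 1 gchoose i) *\<^sub>C
            act M (act (adj V) (conf V) (0 + int i) v) (1 + m - int i) w)"
    using module conf_car v'(1) w'(1) unfolding generalized_module_def module_jacobi_def by blast
  moreover have "Sum_any (\<lambda>i::nat. ((-1) ^ i * (of_int 0 gchoose i)) *\<^sub>C
            (act M (conf V) (1 + 0 - int i) (act M v (m + int i) w)
             - ((-1) powi 0) *\<^sub>C act M v (m + 0 - int i) (act M (conf V) (1 + int i) w)))
      = act M (conf V) 1 (act M v m w) - act M v m (act M (conf V) 1 w)"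
    by (subst Sum_any.expand_superset[of "{0}"]) (auto simp: gbinomial_0_left)
  moreover have "Sum_any (\<lambda>i::nat. (of_int 1 gchoose i) *\<^sub>C
            act M (act (adj V) (conf V) (0 + int i) v) (1 + m - int i) w)
      = act M (act (adj V) (conf V) 0 v) (m + 1) w + act M (act (adj V) (conf V) 1 v) m w"
  proof -
    have "(1::complex) gchoose i = 0" if "i \<noteq> 0" "i \<noteq> 1" for i
      using that binomial_gbinomial[of 1 i, where 'a = complex] by (simp add: binomial_eq_0)
    then have "{i. ((of_int 1 :: complex) gchoose i) *\<^sub>C
            act M (act (adj V) (conf V) (0 + int i) v) (1 + m - int i) w \<noteq> 0} \<subseteq> {0, 1}"
      unfolding subset_iff mem_Collect_eq by (metis cvs.scale_zero_left insertCI of_int_1)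
    then show ?thesis by (subst Sum_any.expand_superset[of "{0, 1}"]) (auto simp: add.commute)
  qed
  moreover have "act M (act (adj V) (conf V) 0 v) (m + 1) w = of_int (- (m + 1)) *\<^sub>C act M v m w"
  proof -
    have "act M (vir V (adj V) (-1) v) (m + 1) w = of_int (- (m + 1)) *\<^sub>C act M v (m + 1 - 1) w"
      using module v'(1) w'(1) unfolding generalized_module_def by blast
    then show ?thesis by (simp add: vir_def)
  qed
  ultimately have "L0 (act M v m w) - n *\<^sub>C act M v m w
      = of_int (- (m + 1)) *\<^sub>C act M v m w + of_int k *\<^sub>C act M v m w"
    using module_car[OF module] v' w' by (simp add: vir_def)
  then have "L0 (act M v m w) = n *\<^sub>C act M v m w
      + (of_int (- (m + 1)) *\<^sub>C act M v m w + of_int k *\<^sub>C act M v m w)"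
    by (simp add: algebra_simps)
  also have "\<dots> = (n + of_int (k - m - 1)) *\<^sub>C act M v m w"
    by (simp only: scaleC_add_left[symmetric]) (simp add: algebra_simps)
  finally show ?thesis
    using module_car[OF module] v' w' by (simp add: L0_space_def)
qed

lemma irreducibleD:
  assumes "cvs.subspace S" "S \<subseteq> car M" "x \<in> S" "x \<noteq> 0"
    and "\<And>v n w. v \<in> car (adj V) \<Longrightarrow> w \<in> S \<Longrightarrow> act M v n w \<in> S"
  shows "S = car M"
proof -
  have "S = {0} \<or> S = car M"
    using irreducible assms(1,2,5) unfolding irreducible_module_def by blast
  then show ?thesis using assms(3,4) by auto
qed

context
  fixes h assumes h: "L0_eigenvalue V M h"
begin

text \<open>Homogeneous elements of V have integer weight and so permute the eigenspaces within h +
  Z by \<open>L0_act\<close>. Their span is a nonzero submodule, hence everything by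
  irreducibility.\<close>

lemma span_L0_spaces: "cvs.span (\<Union>n\<in>{n. n - h \<in> \<int>}. L0_space n) = car M"
proof -
  let ?E = "\<Union>n\<in>{n. n - h \<in> \<int>}. L0_space n"
  have sub: "cvs.span ?E \<subseteq> car M"
    by (rule cvs.span_minimal[OF _ L0.subspace]) (auto simp: L0_space_def)
  have E: "act M v m w \<in> cvs.span ?E" if v: "v \<in> car (adj V)" and w: "w \<in> ?E" for v m w
  proof -
    obtain n where n: "n - h \<in> \<int>" "w \<in> L0_space n" using w by auto
    \<comment> \<open>\<open>L0_act\<close> needs homogeneous v, so v is split into its weight
      components.\<close>
    obtain f where f: "finite {k. f k \<noteq> 0}" "\<And>k. f k \<in> voa_wt V k" "v = Sum_any f"
      using integer_grading[OF v] by blast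
    have "w \<in> car M" using n by (simp add: L0_space_def)
    then have "act M v m w = (\<Sum>k | f k \<noteq> 0. act M (f k) m w)"
      unfolding f(3) Sum_any.expand_set using f(1,2) adjoint_module
      by (intro linear_on_sum[OF act_linear(2)]) (auto simp: generalized_module_def voa_wt_def)
    also have "\<dots> \<in> cvs.span ?E"
    proof (intro cvs.subspace_sum cvs.subspace_span cvs.span_base)
      fix k
      have "(n - h) + of_int (k - m - 1) \<in> \<int>" using n by (intro Ints_add) auto
      then have "n + of_int (k - m - 1) - h \<in> \<int>" by (simp add: algebra_simps)
      then show "act M (f k) m w \<in> ?E" using L0_act[OF f(2) n(2)] by blast
    qed
    finally show ?thesis .
  qed
  have act: "act M v m w \<in> cvs.span ?E" if v: "v \<in> car (adj V)" and w: "w \<in> cvs.span ?E" for v m w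
  proof -
    have "w \<in> car M \<and> act M v m w \<in> cvs.span ?E"
      using w
    proof (induction rule: cvs.span_induct_alt)
      case base
      have "act M v m (0 *\<^sub>C 0) = 0 *\<^sub>C act M v m 0"
        using module_car[OF module] v by metis
      then show ?case using module_car(1)[OF module] by (simp add: cvs.span_zero)
    next
      case (step c x y)
      then have "x \<in> car M" by (auto simp: L0_space_def)
      then show ?case using step E[OF v] module_car[OF module] v
        by (simp add: cvs.span_add cvs.span_scale)
    qed
    then show ?thesis ..
  qed
  obtain x where "x \<in> L0_space h" "x \<noteq> 0" using h by (auto simp: L0_eigenvalue_iff)
  then show ?thesis
    by (intro irreducibleD[OF cvs.subspace_span sub _ _ act]) (auto intro!: cvs.span_base exI[of _ h])
qed

lemma L0_decomposition:
  assumes "w \<in> car M"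
  shows "\<exists>f. finite {n. f n \<noteq> 0} \<and> (\<forall>n. f n \<in> L0_space n \<and> (f n \<noteq> 0 \<longrightarrow> n - h \<in> \<int>)) \<and> w = Sum_any f"
  using assms[folded span_L0_spaces]
proof (induction rule: cvs.span_induct_alt)
  case base
  then show ?case using cvs.subspace_0[OF L0_space_subspace] by (intro exI[of _ "\<lambda>_. 0"]) auto
next
  case (step c x y)
  then obtain f where f: "finite {n. f n \<noteq> 0}"
    "\<And>n. f n \<in> L0_space n \<and> (f n \<noteq> 0 \<longrightarrow> n - h \<in> \<int>)" "y = Sum_any f" by blast
  obtain m where m: "m - h \<in> \<int>" "x \<in> L0_space m" using step by auto
  let ?d = "\<lambda>n. if n = m then c *\<^sub>C x else 0"
  have d: "finite {n. ?d n \<noteq> 0}" by (rule finite_subset[of _ "{m}"]) auto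
  have "finite {n. ?d n + f n \<noteq> 0}"
    by (rule finite_subset[OF _ finite_UnI[OF d f(1)]]) auto
  moreover have "?d n + f n \<in> L0_space n \<and> (?d n + f n \<noteq> 0 \<longrightarrow> n - h \<in> \<int>)" for n
    using f(2)[of n] m L0_space_subspace[of n]
    by (auto intro: cvs.subspace_add cvs.subspace_scale)
  moreover have "c *\<^sub>C x + y = Sum_any (\<lambda>n. ?d n + f n)"
    using Sum_any.distrib[OF d f(1)] f(3) by simp
  ultimately show ?case by (intro exI[of _ "\<lambda>n. ?d n + f n"]) blast
qed

lemma wt_comp_L0_space:
  assumes "w \<in> car M"
  shows "finite {n. wt_comp V M w n \<noteq> 0}" "w = Sum_any (wt_comp V M w)"
    "wt_comp V M w n \<in> L0_space n" "wt_comp V M w n \<noteq> 0 \<Longrightarrow> n - h \<in> \<int>"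
proof -
  obtain f where f: "finite {n. f n \<noteq> 0}"
    "\<And>n. f n \<in> L0_space n \<and> (f n \<noteq> 0 \<longrightarrow> n - h \<in> \<int>)" "w = Sum_any f"
    using L0_decomposition[OF assms] by blast
  moreover have "wt_comp V M w = f" using f L0_space_gwt by (intro wt_comp_eqI) auto
  ultimately show "finite {n. wt_comp V M w n \<noteq> 0}" "w = Sum_any (wt_comp V M w)"
    "wt_comp V M w n \<in> L0_space n" "wt_comp V M w n \<noteq> 0 \<Longrightarrow> n - h \<in> \<int>" by auto
qed

lemma L0_eigenvalue_diff_Ints:
  assumes "L0_eigenvalue V M n"
  shows "n - h \<in> \<int>"
proof -
  obtain w where w: "w \<in> L0_space n" "w \<noteq> 0" using assms by (auto simp: L0_eigenvalue_iff)
  have "wt_comp V M w = (\<lambda>m. if m = n then w else 0)"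
  proof (rule wt_comp_eqI)
    show "finite {m. (if m = n then w else 0) \<noteq> 0}" by (rule finite_subset[of _ "{n}"]) auto
    show "(if m = n then w else 0) \<in> gwt V M m" for m
      using w L0_space_gwt cvs.subspace_0[OF L0_space_subspace, of m] by auto
  qed simp
  then show ?thesis using wt_comp_L0_space(4)[of w n] w by (auto simp: L0_space_def)
qed

text \<open>The weight components are true eigenvectors, so only the terms with k = 0 survive, and
  exp (2 pi i n) depends only on the class of n modulo Z, which is that of h.\<close>

lemma exp_L0_scalar:
  assumes "w \<in> car M"
  shows "exp_L0 V M (2 * complex_of_real pi * \<i>) w = exp (2 * complex_of_real pi * \<i> * h) *\<^sub>C w"
proof -
  note wt = wt_comp_L0_space[OF assms]
  let ?f = "wt_comp V M w" and ?z = "2 * complex_of_real pi * \<i>"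
  let ?g = "\<lambda>(n, k::nat). (exp (?z * n) * ?z ^ k / fact k) *\<^sub>C (L0.shift n ^^ k) (?f n)"
  have g: "?g (n, k) = (if k = 0 then exp (?z * h) *\<^sub>C ?f n else 0)" for n k
  proof (cases k)
    case 0
    have "exp (?z * n) = exp (?z * h)" if "?f n \<noteq> 0"
    proof -
      have "n - h \<in> \<int>" using wt(4) that by blast
      then obtain i where "n - h = of_int i" by (elim Ints_cases)
      then have "exp (?z * (n - h)) = 1"
        using exp_integer_2pi[of "of_int i"] by (simp add: mult_ac)
      then show ?thesis by (simp add: right_diff_distrib exp_diff)
    qed
    then show ?thesis using 0 by auto
  next
    case (Suc j)
    then show ?thesis using L0_space_shift[OF wt(3)[of n], of j] by simp
  qed
  have "exp_L0 V M ?z w = Sum_any ?g"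
    by (simp add: exp_L0_def L0.shift_def[abs_def])
  also have "\<dots> = sum ?g ((\<lambda>n. (n, 0)) ` {n. ?f n \<noteq> 0})"
  proof (rule Sum_any.expand_superset)
    show "{a. ?g a \<noteq> 0} \<subseteq> (\<lambda>n. (n, 0)) ` {n. ?f n \<noteq> 0}"
    proof
      fix a assume "a \<in> {a. ?g a \<noteq> 0}"
      then show "a \<in> (\<lambda>n. (n, 0)) ` {n. ?f n \<noteq> 0}"
        using g[of "fst a" "snd a"] by (cases a) (auto split: if_splits)
    qed
  qed (use wt(1) in simp)
  also have "\<dots> = (\<Sum>n | ?f n \<noteq> 0. ?g (n, 0))"
    by (subst sum.reindex) (auto simp: inj_on_def)
  also have "\<dots> = exp (?z * h) *\<^sub>C (\<Sum>n | ?f n \<noteq> 0. ?f n)"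
    unfolding g by (simp add: cvs.scale_sum_right)
  also have "(\<Sum>n | ?f n \<noteq> 0. ?f n) = w"
    using wt(2) by (simp add: Sum_any.expand_set)
  finally show ?thesis .
qed

end

text \<open>All eigenvalues lie in one coset h + Z and the grading restriction bounds them below, so
  a lowest one exists. Minimality of the real part determines it, since two eigenvalues differ by an
  integer.\<close>

lemma conformal_dim_eigenvalue: "L0_eigenvalue V M (conformal_dim V M)"
proof -
  obtain h where h: "L0_eigenvalue V M h" using L0_eigenvalue_exists ..
  obtain N :: nat where N: "\<And>k. k \<ge> N \<Longrightarrow> gwt V M (h - of_nat k) = {0}"
    using restricted[unfolded grading_restricted_def, THEN conjunct2, THEN spec, of h] by blast
  have low: "\<not> L0_eigenvalue V M (h + of_int i)" if "i \<le> - int N" for i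
  proof
    assume "L0_eigenvalue V M (h + of_int i)"
    then obtain w where "w \<in> gwt V M (h + of_int i)" "w \<noteq> 0"
      using L0_space_gwt by (auto simp: L0_eigenvalue_iff)
    then show False using N[of "nat (- i)"] that by simp
  qed
  \<comment> \<open>Shifting by N makes the candidates natural numbers, so \<open>LEAST\<close>
    applies; j = N is h itself.\<close>
  let ?P = "\<lambda>j::nat. L0_eigenvalue V M (h + of_int (int j - int N))"
  define j where "j = (LEAST j. ?P j)"
  have "?P N" using h by simp
  then have j: "?P j" "\<And>i. ?P i \<Longrightarrow> j \<le> i"
    unfolding j_def using LeastI[of ?P N] Least_le[of ?P] by blast+
  let ?h = "h + of_int (int j - int N)"
  have "conformal_dim V M = ?h"
    unfolding conformal_dim_def
  proof (rule the_equality)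
    have "Re ?h \<le> Re n" if n: "L0_eigenvalue V M n" for n
    proof -
      obtain i where i: "n = h + of_int i"
        using L0_eigenvalue_diff_Ints[OF h n] by (auto elim!: Ints_cases simp: algebra_simps)
      then have "\<not> i \<le> - int N" using low n by blast
      then have "?P (nat (i + int N))" using n i by simp
      then have "j \<le> nat (i + int N)" by (rule j)
      then have "int j - int N \<le> i" using \<open>\<not> i \<le> - int N\<close> by linarith
      then have "real_of_int (int j - int N) \<le> real_of_int i" by (simp only: of_int_le_iff)
      then show ?thesis using i by simp
    qed
    then show *: "L0_eigenvalue V M ?h \<and> (\<forall>n. L0_eigenvalue V M n \<longrightarrow> Re ?h \<le> Re n)"
      using j by blast
    fix n assume n: "L0_eigenvalue V M n \<and> (\<forall>m. L0_eigenvalue V M m \<longrightarrow> Re n \<le> Re m)"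
    then have "Re n = Re ?h" using * by (meson order_antisym)
    moreover obtain i where "n = ?h + of_int i"
      using L0_eigenvalue_diff_Ints[of ?h n] n j by (auto elim!: Ints_cases simp: algebra_simps)
    ultimately show "n = ?h" by simp
  qed
  then show ?thesis using j by simp
qed

lemma twist_irreducible: "twist V M = scale_arr (exp (2 * pi * \<i> * conformal_dim V M)) (id_arr M)"
  by (rule arr_eqI) (auto simp: twist_def id_arr_def exp_L0_scalar[OF conformal_dim_eigenvalue])

text \<open>\<open>f\<close> commutes with L(0), so the orbit of a weight vector stays in a
  finite-dimensional weight space and \<open>f\<close> has an eigenvector there. The full eigenspace
  of \<open>f\<close> for that eigenvalue is a submodule, hence all of M.\<close>

lemma schur:
  assumes f: "f \<in> hom V M M"
  shows "\<exists>c. f = scale_arr c (id_arr M)"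
proof -
  interpret f: linear_endomorphism "car M" "app f"
    using L0.subspace homD(3)[OF f] by unfold_locales
  obtain h where h: "L0_eigenvalue V M h" using L0_eigenvalue_exists ..
  then obtain w where w: "w \<in> L0_space h" "w \<noteq> 0" by (auto simp: L0_eigenvalue_iff)
  have pow: "(app f ^^ i) w \<in> L0_space h" for i
    by (induction i) (use w homD(4,6,8)[OF f] conf_car in \<open>auto simp: L0_space_def vir_def simp flip: homD(4)[OF f]\<close>)
  obtain B where B: "finite B" "gwt V M h \<subseteq> cvs.span B"
    using restricted[unfolded grading_restricted_def, THEN conjunct1, THEN spec, of h] by blast
  then have span: "(app f ^^ i) w \<in> cvs.span B" for i
    using pow L0_space_gwt by blast
  obtain c y where y: "y \<in> car M" "y \<noteq> 0" "app f y = c *\<^sub>C y"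
    using f.eigenvector_exists[OF L0_space_car[OF w(1)] w(2) B(1) span] by blast
  let ?S = "{x \<in> car M. app f x = c *\<^sub>C x}"
  have "?S = car M"
  proof (rule irreducibleD[of ?S y])
    show "cvs.subspace ?S"
      using module_car[OF module] homD(7,8)[OF f] hom_zero[OF f]
      by (auto simp: cvs.subspace_def scaleC_add_right cvs.scale_left_commute)
    show "act M v n x \<in> ?S" if "v \<in> car (adj V)" "x \<in> ?S" for v n x
      using that module_car[OF module] homD(4)[OF f] by simp
  qed (use y in auto)
  then have "f = scale_arr c (id_arr M)"
    using scale_arr_hom[OF module id_arr_hom[OF module], of c]
    by (intro hom_eqI[OF f]) auto
  then show ?thesis ..
qed

end

section \<open>The braiding of a self-dual simple current\<close>

theorem theorem1p4:
  fixes V :: "'a::complex_vector_space voa" and C :: "'a tensor_data"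
    and R :: "'a ribbon_data" and J :: "'a vmod"
  assumes "ribbon_vertex_tensor_category V C R"
    and "module_tensor_data.self_dual_current V C J"
  shows "module_tensor_data.braiding_scalar C J * module_ribbon_data.qdim V C R J =
    exp (2 * pi * \<i> * conformal_dim V J)"
proof -
  interpret ribbon_vertex_tensor_category V C R by fact
  have J: "J \<in> obj C" "irreducible_module V J" "isomorphic V (J \<otimes> J) \<one>"
    using assms(2) by (auto simp: self_dual_current_def simple_current_def)
  interpret J: irreducible_voa_module V J
    using obj_module J by unfold_locales auto
  obtain \<phi> where \<phi>: "\<phi> \<in> iso V (J \<otimes> J) \<one>" using J(3) by (auto simp: isomorphic_def)
  obtain x where x: "x \<in> car J" "x \<noteq> 0"
    using J(2) module_car(1)[OF J.module] by (auto simp: irreducible_module_def)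
  have vac_car: "vac V \<in> car (adj V)" using vac_in by (simp add: voa_wt_def)
  \<comment> \<open>The mode -1 of the vacuum acts as the identity on J, which is nonzero.\<close>
  have vac: "vac V \<noteq> 0"
  proof
    assume "vac V = 0"
    then have "act J (0 *\<^sub>C vac V) (-1) x = x"
      using J.module x by (simp add: generalized_module_def)
    then show False using module_car(8)[OF J.module vac_car x(1), of 0 "-1"] x(2) by simp
  qed
  \<comment> \<open>The preimage of the vacuum witnesses that J \<otimes> J is nonzero, so the
    scalar of c_{J,J} is determined.\<close>
  let ?y = "app (inv_arr V \<phi>) (vac V)"
  have "app (\<phi> \<cdot> inv_arr V \<phi>) (vac V) = vac V"
    using iso_inv(3)[OF \<phi>] vac_car by simp
  then have "?y \<noteq> 0"
    using vac hom_zero[of \<phi> V "J \<otimes> J" \<one>] \<phi> by (auto simp: iso_def)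
  moreover have "?y \<in> car (J \<otimes> J)" using homD(6)[OF iso_inv(1)[OF \<phi>] vac_car] .
  ultimately show ?thesis
    using braiding_scalar_qdim[OF J(1) \<phi> J.schur J.twist_irreducible x vac] by blast
qed

end
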